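(* Let $r_1,r_2,c_1,c_2$ be positive integers and let $A\in\mathbb C^{r_1\times c_1}$, $B\in\mathbb C^{r_2\times c_1}$, $D\in\mathbb C^{r_2\times c_2}$. Set $$T=\begin{pmatrix} A & 0 \\ B & D \end{pmatrix},\qquad \alpha=\|A\|_F^2,\quad\beta=\|B\|_F^2,\quad\gamma=\|D\|_F^2,$$ and assume $\alpha+\beta+\gamma=1$. Then $$S(TT^\dagger)\ge e(2\sqrt{\alpha\gamma})+\alpha S(AA^\dagger/\alpha)+\beta S(BB^\dagger/\beta)+\gamma S(DD^\dagger/\gamma),$$ where a weighted entropy term is taken to be zero when its weight vanishes.
   Context: $\|M\|_F=(\operatorname{Tr}M^\dagger M)^{1/2}$ is the Frobenius norm. $S(\rho)=-\operatorname{Tr}\rho\log_2\rho$ is the von Neumann entropy of a positive semidefinite matrix of trace one. $h_2(x)=-x\log_2x-(1-x)\log_2(1-x)$ with $0\log_20=0$, and $$e(c)=h_2\!\left(\frac{1+\sqrt{1-c^2}}2\right),\qquad 0\le c\le1.$$ *)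

theory Defs
  imports Complex_Main "Jordan_Normal_Form.Schur_Decomposition"
begin

definition unitary_mat :: "nat \<Rightarrow> complex mat \<Rightarrow> bool" where
  "unitary_mat n U \<longleftrightarrow> U \<in> carrier_mat n n \<and> mat_adjoint U * U = 1\<^sub>m n"

definition diag_of_reals :: "nat \<Rightarrow> (nat \<Rightarrow> real) \<Rightarrow> complex mat" where
  "diag_of_reals n d = mat_diag n (\<lambda>i. complex_of_real (d i))"

text \<open>The functional calculus: f is applied to the eigenvalues in a unitary diagonalization.
  The value does not depend on the diagonalization chosen (\<open>herm_fun_eq\<close> below);
  it is unspecified if M is not Hermitian.\<close>

definition herm_fun :: "(real \<Rightarrow> real) \<Rightarrow> complex mat \<Rightarrow> complex mat" where
  "herm_fun f M = (THE N. \<exists>U d.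
     unitary_mat (dim_row M) U \<and>
     M = U * diag_of_reals (dim_row M) d * mat_adjoint U \<and>
     N = U * diag_of_reals (dim_row M) (f \<circ> d) * mat_adjoint U)"

lemma mat_adjoint_carrier [simp, intro]:
  fixes A :: "complex mat"
  shows "A \<in> carrier_mat r c \<Longrightarrow> mat_adjoint A \<in> carrier_mat c r"
  unfolding mat_adjoint_def by auto

lemma diag_of_reals_carrier [simp]: "diag_of_reals n d \<in> carrier_mat n n"
  unfolding diag_of_reals_def by simp

lemma herm_fun_unique:
  assumes U: "unitary_mat n U" and V: "unitary_mat n V"
    and eq: "U * diag_of_reals n d * mat_adjoint U = V * diag_of_reals n e * mat_adjoint V"
  shows "U * diag_of_reals n (f \<circ> d) * mat_adjoint U
       = V * diag_of_reals n (f \<circ> e) * mat_adjoint V"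
proof -
  define U' V' where "U' = mat_adjoint U" and "V' = mat_adjoint V"
  define D E fD fE where "D = diag_of_reals n d" and "E = diag_of_reals n e"
    and "fD = diag_of_reals n (f \<circ> d)" and "fE = diag_of_reals n (f \<circ> e)"
  note defs = U'_def V'_def D_def E_def fD_def fE_def
  have c: "U \<in> carrier_mat n n" "V \<in> carrier_mat n n"
    "U' \<in> carrier_mat n n" "V' \<in> carrier_mat n n"
    using U V by (auto simp: unitary_mat_def defs)
  have cD: "D \<in> carrier_mat n n" "E \<in> carrier_mat n n"
    "fD \<in> carrier_mat n n" "fE \<in> carrier_mat n n"
    by (simp_all add: defs)
  note mc = mult_carrier_mat[of _ n n _ n] assoc_mult_mat[of _ n n _ n _ n]
  have U'U: "U' * U = 1\<^sub>m n" and V'V: "V' * V = 1\<^sub>m n"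
    using U V by (auto simp: unitary_mat_def defs)
  have UU': "U * U' = 1\<^sub>m n" and VV': "V * V' = 1\<^sub>m n"
    using mat_mult_left_right_inverse[OF c(3,1) U'U]
      mat_mult_left_right_inverse[OF c(4,2) V'V] by simp_all
  have eq': "U * D * U' = V * E * V'"
    using eq by (simp add: defs)
  define W where "W = V' * U"
  have cW: "W \<in> carrier_mat n n"
    unfolding W_def using c(4,1) by (rule mult_carrier_mat)
  have "W * D = V' * (U * D * U') * U"
    using c cD U'U by (simp add: W_def mc)
  also have "\<dots> = (V' * V) * E * (V' * U)"
    unfolding eq' using c cD by (simp add: mc)
  also have "\<dots> = E * W"
    using c cD V'V by (simp add: W_def mc)
  finally have WD: "W * D = E * W" .
  have right: "(W * diag_of_reals n g) $$ (i, j) = W $$ (i, j) * of_real (g j)"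
    if "i < n" "j < n" for i j g
    using that mat_diag_mult_right[OF cW] by (simp add: diag_of_reals_def)
  have left: "(diag_of_reals n g * W) $$ (i, j) = of_real (g i) * W $$ (i, j)"
    if "i < n" "j < n" for i j g
    using that mat_diag_mult_left[OF cW] by (simp add: diag_of_reals_def)
  have "W * fD = fE * W"
  proof (rule eq_matI)
    fix i j assume "i < dim_row (fE * W)" "j < dim_col (fE * W)"
    then have ij: "i < n" "j < n" using cW cD by auto
    have "W $$ (i, j) * of_real (d j) = of_real (e i) * W $$ (i, j)"
      using WD right[OF ij, of d] left[OF ij, of e] by (auto simp: D_def E_def)
    then have "W $$ (i, j) = 0 \<or> d j = e i" by (simp add: mult.commute)
    then show "(W * fD) $$ (i, j) = (fE * W) $$ (i, j)"
      unfolding fD_def fE_def right[OF ij] left[OF ij] by auto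
  qed (use cW cD in auto)
  then have "V * (W * fD) * U' = V * (fE * W) * U'" by simp
  moreover have "V * (W * fD) * U' = (V * V') * (U * fD * U')"
    using c cD by (simp add: W_def mc)
  moreover have "V * (fE * W) * U' = V * fE * V' * (U * U')"
    using c cD by (simp add: W_def mc)
  ultimately have "U * fD * U' = V * fE * V'"
    using VV' UU' c cD by (simp add: mc)
  then show ?thesis by (simp add: defs)
qed

lemma herm_fun_eq:
  assumes U: "unitary_mat n U"
  shows "herm_fun f (U * diag_of_reals n d * mat_adjoint U)
       = U * diag_of_reals n (f \<circ> d) * mat_adjoint U"
proof -
  have n: "dim_row (U * diag_of_reals n d * mat_adjoint U) = n"
    using U by (auto simp: unitary_mat_def)
  show ?thesis
    unfolding herm_fun_def n
    using U by (intro the_equality) (blast, metis herm_fun_unique)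
qed

definition mat_trace :: "complex mat \<Rightarrow> complex" where
  "mat_trace M = (\<Sum>i<dim_row M. M $$ (i, i))"

text \<open>In the next two definitions the convention that \<open>0 log 0\<close> is zero holds
  because the factor \<open>x\<close> vanishes.\<close>

definition vn_entropy :: "complex mat \<Rightarrow> real" where
  "vn_entropy \<rho> = - Re (mat_trace (herm_fun (\<lambda>x. x * log 2 x) \<rho>))"

definition h2 :: "real \<Rightarrow> real" where
  "h2 x = - x * log 2 x - (1 - x) * log 2 (1 - x)"

definition e_fun :: "real \<Rightarrow> real" where
  "e_fun c = h2 ((1 + sqrt (1 - c\<^sup>2)) / 2)"

definition frob_norm :: "complex mat \<Rightarrow> real" where
  "frob_norm M = sqrt (Re (mat_trace (mat_adjoint M * M)))"

text \<open>The term \<open>w S(M M\<^sup>\<dagger> / w)\<close>.\<close>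

definition weighted_entropy :: "real \<Rightarrow> complex mat \<Rightarrow> real" where
  "weighted_entropy w M =
     (if w = 0 then 0
      else w * vn_entropy (complex_of_real (1 / w) \<cdot>\<^sub>m (M * mat_adjoint M)))"

end

theory Submission
  imports Defs "HOL-Analysis.Convex"
begin

text \<open>Two spectra with the same sum whose functions \<open>log det (1 + t M)\<close> are ordered for all \<open>t > 0\<close>
  have ordered entropies, because \<open>- x ln x\<close> is, up to terms linear in \<open>x\<close>, the integral of
  \<open>ln (1 + t x) / t\<^sup>2\<close>. So the entropies of \<open>T\<close>, \<open>A\<close>, \<open>D\<close> are compared for each \<open>t\<close> through
  \<open>det (1 + t T T\<^sup>\<dagger>) = det [[X, - \<surd>t B\<^sup>\<dagger>], [\<surd>t B, Z]]\<close>, where \<open>X = 1 + t A\<^sup>\<dagger> A\<close> and \<open>Z = 1 + t D D\<^sup>\<dagger>\<close>.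

  In singular bases of \<open>B\<close>, with singular values \<open>b j\<close>, the quotient of this determinant by
  \<open>det X det Z\<close> can only decrease when \<open>X\<close> and \<open>Z\<close> are replaced by their diagonals: up to a
  congruence it is \<open>|det (H + iJ)| / det H\<close> with \<open>H\<close> positive definite and \<open>J\<close> real diagonal, and
  coordinates of \<open>H\<close> can be decoupled one after the other.

  This decouples the problem into triples \<open>(a j, b j\<^sup>2, g j)\<close> of nonnegative numbers summing to
  \<open>(\<alpha>, \<beta>, \<gamma>)\<close>. The function of a triple that has to be superadditive is homogeneous of degree one
  and, by the same integral, concave: \<open>ln (1 + c / (x z))\<close> is convex in \<open>x, z > 0\<close>.\<close>

section \<open>Entropy comparison from logarithmic determinants\<close>

text \<open>The function e is the entropy of the smallest case. If all blocks are scalars,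
  \<open>T T\<^sup>\<dagger>\<close> has trace a + b + g = 1 and determinant a g, its eigenvalues
  are the two probabilities inside \<open>h2\<close>, and the inequality is an equality. In general
  each singular value of B sees one such scalar problem, whose other two weights are diagonal
  entries of \<open>A\<^sup>\<dagger> A\<close> and \<open>D D\<^sup>\<dagger>\<close> in the
  singular bases of B.

  Passing to diagonals changes the spectra belonging to A and D as well as the one belonging to T.
  Hence no single entropy is estimated: only the balance log det (T part) - log det X - log det Z
  is, for each t. The entropy of B has no determinant in this balance. It depends on the singular
  values alone, which the reduction keeps, so it is subtracted unchanged on both sides.

  The coupling is skew, so the block matrix is not Hermitian and determinant inequalities for
  positive matrices do not apply to it as it stands. Diagonalizing the coupling turns it into an
  imaginary shift of a positive matrix, and the inequality needed is one that holds for every real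
  size of that shift.\<close>

lemma sum_list_mult_const_right:
  fixes f :: "'a \<Rightarrow> real"
  shows "(\<Sum>x\<leftarrow>xs. f x * c) = (\<Sum>x\<leftarrow>xs. f x) * c"
  by (induction xs) (auto simp: algebra_simps)

text \<open>An explicit antiderivative \<open>G\<close> replaces the improper integral. It is
  nondecreasing on t > 0, since its derivative is the sum in \<open>log\<close> divided by
  \<open>t\<^sup>2\<close>, and it rises from limit 0 at 0 to minus the sum in the conclusion at
  infinity. Signed coefficients \<open>c\<close> let several spectra enter one comparison.\<close>

lemma weighted_entropy_from_log_det:
  fixes L :: "(real \<times> real) list"
  assumes nonneg: "\<And>c x. (c, x) \<in> set L \<Longrightarrow> 0 \<le> x"
    and sum0: "(\<Sum>(c, x)\<leftarrow>L. c * x) = 0"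
    and log: "\<And>t. 0 < t \<Longrightarrow> 0 \<le> (\<Sum>(c, x)\<leftarrow>L. c * ln (1 + t * x))"
  shows "(\<Sum>(c, x)\<leftarrow>L. c * (x * ln x)) \<le> 0"
proof -
  define G where "G t = (\<Sum>(c, x)\<leftarrow>L. c * (- (ln (1 + t * x) / t) - x * ln (1 + t * x)))" for t
  have pos: "0 < 1 + t * x" if "(c, x) \<in> set L" "0 < t" for t c x
    using nonneg[OF that(1)] that(2) by (simp add: add_pos_nonneg)
  have G_deriv: "(G has_real_derivative (\<Sum>(c, x)\<leftarrow>L. c * (ln (1 + t * x) / t\<^sup>2 - x / t))) (at t)"
    if t: "0 < t" for t
  proof -
    have "((\<lambda>t. \<Sum>(c, x)\<leftarrow>K. c * (- (ln (1 + t * x) / t) - x * ln (1 + t * x))) has_real_derivative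
        (\<Sum>(c, x)\<leftarrow>K. c * (ln (1 + t * x) / t\<^sup>2 - x / t))) (at t)"
      if "set K \<subseteq> set L" for K
      using that
    proof (induction K)
      case (Cons cx K)
      obtain c x where cx: "cx = (c, x)" by force
      have p: "0 < 1 + t * x" using pos[OF _ t, of c x] Cons.prems cx by auto
      have "((\<lambda>t. c * (- (ln (1 + t * x) / t) - x * ln (1 + t * x))) has_real_derivative
          c * (- (x / (1 + t * x) * t - ln (1 + t * x)) / (t * t) - x * (x / (1 + t * x)))) (at t)"
        using p t by (auto intro!: derivative_eq_intros simp: field_simps)
      moreover have "- (x / (1 + t * x) * t - ln (1 + t * x)) / (t * t) - x * (x / (1 + t * x))
          = ln (1 + t * x) / t\<^sup>2 - x / t"
      proof -
        have "x / (1 + t * x) / t + x * (x / (1 + t * x)) = x / t"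
          using p t by (simp add: divide_simps) (simp add: algebra_simps)
        moreover have "- (x / (1 + t * x) * t - ln (1 + t * x)) / (t * t)
            = ln (1 + t * x) / t\<^sup>2 - x / (1 + t * x) / t"
          using t by (simp add: diff_divide_distrib power2_eq_square)
        ultimately show ?thesis by simp
      qed
      ultimately have "((\<lambda>t. c * (- (ln (1 + t * x) / t) - x * ln (1 + t * x))) has_real_derivative
          c * (ln (1 + t * x) / t\<^sup>2 - x / t)) (at t)" by simp
      then show ?case using Cons cx by (auto intro!: DERIV_add)
    qed simp
    then show ?thesis unfolding G_def by blast
  qed
  \<comment> \<open>By \<open>sum0\<close>, a common multiple of \<open>x\<close> may be added to
    all summands. This removes \<open>y / x\<close> from the derivative, inserts \<open>ln t\<close>
    into the limit at infinity and makes the limit at 0 vanish.\<close>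
  have lin: "(\<Sum>(c, x)\<leftarrow>L. c * (f x + k * x)) = (\<Sum>(c, x)\<leftarrow>L. c * f x)" for f :: "real \<Rightarrow> real" and k
  proof -
    have "(\<Sum>(c, x)\<leftarrow>K. c * (f x + k * x)) = (\<Sum>(c, x)\<leftarrow>K. c * f x) + k * (\<Sum>(c, x)\<leftarrow>K. c * x)" for K
      by (induction K) (auto simp: algebra_simps)
    then show ?thesis using sum0 by simp
  qed
  have mono: "G s \<le> G t" if "0 < s" "s \<le> t" for s t
  proof (rule DERIV_nonneg_imp_nondecreasing[OF that(2)])
    fix x assume "s \<le> x" "x \<le> t"
    then have x: "0 < x" using that by simp
    have "(\<Sum>(c, y)\<leftarrow>L. c * (ln (1 + x * y) / x\<^sup>2 - y / x))
        = (\<Sum>(c, y)\<leftarrow>L. c * (ln (1 + x * y) / x\<^sup>2))"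
      using lin[of "\<lambda>y. ln (1 + x * y) / x\<^sup>2" "- (1 / x)"] by (simp add: case_prod_unfold)
    also have "\<dots> = (\<Sum>(c, y)\<leftarrow>L. c * ln (1 + x * y)) * (1 / x\<^sup>2)"
      unfolding sum_list_mult_const_right[symmetric] by (simp add: case_prod_unfold)
    also have "\<dots> \<ge> 0" using log[OF x] by simp
    finally show "\<exists>y. (G has_real_derivative y) (at x) \<and> 0 \<le> y" using G_deriv[OF x] by blast
  qed
  have lim0: "(G \<longlongrightarrow> (\<Sum>(c, x)\<leftarrow>L. c * (- x - x * 0))) (at_right 0)"
  proof -
    have "((\<lambda>t. \<Sum>(c, x)\<leftarrow>K. c * (- (ln (1 + t * x) / t) - x * ln (1 + t * x)))
        \<longlongrightarrow> (\<Sum>(c, x)\<leftarrow>K. c * (- x - x * 0))) (at_right 0)" for K :: "(real \<times> real) list"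
    proof (induction K)
      case (Cons cx K)
      obtain c x where cx: "cx = (c, x)" by force
      have "((\<lambda>t. ln (1 + t * x)) has_real_derivative x) (at 0)"
        by (auto intro!: derivative_eq_intros)
      then have "((\<lambda>t. ln (1 + t * x) / t) \<longlongrightarrow> x) (at 0)"
        by (simp add: has_field_derivative_iff)
      then have 1: "((\<lambda>t. ln (1 + t * x) / t) \<longlongrightarrow> x) (at_right 0)"
        by (rule filterlim_mono) (auto simp: at_le)
      have "((\<lambda>t. ln (1 + t * x)) \<longlongrightarrow> ln (1 + 0 * x)) (at_right 0)"
        by (intro tendsto_intros) auto
      then have 2: "((\<lambda>t. ln (1 + t * x)) \<longlongrightarrow> 0) (at_right 0)" by simp
      have "((\<lambda>t. c * (- (ln (1 + t * x) / t) - x * ln (1 + t * x))) \<longlongrightarrow> c * (- x - x * 0)) (at_right 0)"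
        by (intro tendsto_intros 1 2)
      from tendsto_add[OF this Cons] show ?case unfolding cx by simp
    qed simp
    then show ?thesis unfolding G_def by blast
  qed
  have lim1: "(G \<longlongrightarrow> (\<Sum>(c, x)\<leftarrow>L. c * (- 0 - x * ln x))) at_top"
  proof -
    \<comment> \<open>After subtracting \<open>ln t\<close> each term converges on its own; in
      \<open>G\<close> itself the divergent parts cancel only in the whole sum.\<close>
    have "((\<lambda>t. \<Sum>(c, x)\<leftarrow>K. c * (- (ln (1 + t * x) / t) - x * (ln (1 + t * x) - ln t)))
        \<longlongrightarrow> (\<Sum>(c, x)\<leftarrow>K. c * (- 0 - x * ln x))) at_top" if "set K \<subseteq> set L" for K
      using that
    proof (induction K)
      case (Cons cx K)
      obtain c x where cx: "cx = (c, x)" by force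
      show ?case
      proof (cases "x = 0")
        case True
        then show ?thesis using Cons cx by simp
      next
        case False
        then have x: "0 < x" using nonneg[of c x] Cons.prems cx by auto
        have inv: "((\<lambda>t::real. 1 / t) \<longlongrightarrow> 0) at_top"
          by (rule tendsto_divide_0[OF tendsto_const]) (simp add: filterlim_at_top_imp_at_infinity filterlim_ident)
        have "((\<lambda>t. ln (1 / t + x)) \<longlongrightarrow> ln (0 + x)) at_top"
          using x by (intro tendsto_intros inv) auto
        moreover have "\<forall>\<^sub>F t in at_top. ln (1 / t + x) = ln (1 + t * x) - ln t"
          using eventually_gt_at_top[of "0::real"]
        proof eventually_elim
          case (elim t)
          have "1 / t + x = (1 + t * x) / t" using elim by (simp add: field_simps)
          moreover have "0 < 1 + t * x" using elim x by (simp add: add_pos_pos)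
          ultimately show ?case using elim by (simp add: ln_div)
        qed
        ultimately have 1: "((\<lambda>t. ln (1 + t * x) - ln t) \<longlongrightarrow> ln x) at_top"
          by (simp add: filterlim_cong[OF refl refl])
        have "((\<lambda>t. (ln (1 + t * x) - ln t) * (1 / t) + ln t / t) \<longlongrightarrow> ln x * 0 + 0) at_top"
          by (intro tendsto_intros 1 inv ln_x_over_x_tendsto_0)
        then have 2: "((\<lambda>t. ln (1 + t * x) / t) \<longlongrightarrow> 0) at_top"
          by (simp add: diff_divide_distrib)
        have "((\<lambda>t. c * (- (ln (1 + t * x) / t) - x * (ln (1 + t * x) - ln t)))
            \<longlongrightarrow> c * (- 0 - x * ln x)) at_top"
          by (intro tendsto_intros 1 2)
        from tendsto_add[OF this Cons.IH] show ?thesis using Cons.prems unfolding cx by simp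
      qed
    qed simp
    from this[OF order_refl] have "((\<lambda>t. \<Sum>(c, x)\<leftarrow>L. c * (- (ln (1 + t * x) / t) - x * (ln (1 + t * x) - ln t)))
        \<longlongrightarrow> (\<Sum>(c, x)\<leftarrow>L. c * (- 0 - x * ln x))) at_top" .
    moreover have "(\<Sum>(c, x)\<leftarrow>L. c * (- (ln (1 + t * x) / t) - x * (ln (1 + t * x) - ln t))) = G t" for t
      using lin[of "\<lambda>x. - (ln (1 + t * x) / t) - x * ln (1 + t * x)" "ln t"]
      unfolding G_def by (simp add: case_prod_unfold algebra_simps)
    ultimately show ?thesis by simp
  qed
  have s0: "(\<Sum>(c, x)\<leftarrow>L. c * (- x - x * 0)) = 0"
    using lin[of "\<lambda>x. 0" "-1"] by (simp add: case_prod_unfold)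
  have "0 \<le> (\<Sum>(c, x)\<leftarrow>L. c * (- 0 - x * ln x))"
  proof (rule tendsto_lowerbound[OF lim1])
    show "\<forall>\<^sub>F t in at_top. 0 \<le> G t"
      using eventually_gt_at_top[of "0::real"]
    proof eventually_elim
      case (elim t)
      have "\<forall>\<^sub>F s in at_right 0. G s \<le> G t"
        using eventually_at_right_less[of 0] eventually_at_right_field[of "\<lambda>s. s \<le> t" 0] elim
        by (smt (verit) eventually_at_right_field mono)
      from tendsto_upperbound[OF lim0 this] show ?case using s0 by simp
    qed
  qed simp
  also have "\<dots> = - (\<Sum>(c, x)\<leftarrow>L. c * (x * ln x))"
    by (induction L) auto
  finally show ?thesis by simp
qed

section \<open>Superadditivity for scalar triples\<close>

text \<open>This and \<open>small_root\<close> are the eigenvalues of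
  \<open>T T\<^sup>\<dagger>\<close> for the 2 x 2 matrix T with rows (sqrt a, 0) and (sqrt b, sqrt
  g): their sum is the trace a + b + g and their product the determinant a g.\<close>

definition big_root :: "real \<Rightarrow> real \<Rightarrow> real \<Rightarrow> real" where
  "big_root a b g = (a + b + g + sqrt ((a + b + g)\<^sup>2 - 4 * a * g)) / 2"

definition small_root :: "real \<Rightarrow> real \<Rightarrow> real \<Rightarrow> real" where
  "small_root a b g = (a + b + g - sqrt ((a + b + g)\<^sup>2 - 4 * a * g)) / 2"

lemma roots_sum: "big_root a b g + small_root a b g = a + b + g"
  by (simp add: big_root_def small_root_def field_simps)

lemma disc_nonneg:
  fixes a b g :: real
  assumes "0 \<le> a" "0 \<le> b" "0 \<le> g"
  shows "0 \<le> (a + b + g)\<^sup>2 - 4 * a * g"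
proof -
  have "(a + b + g)\<^sup>2 - 4 * a * g = (a - g)\<^sup>2 + b * (b + 2 * a + 2 * g)"
    by (simp add: power2_eq_square algebra_simps)
  also have "\<dots> \<ge> 0" using assms by simp
  finally show ?thesis .
qed

lemma roots_prod:
  assumes "0 \<le> a" "0 \<le> b" "0 \<le> g"
  shows "big_root a b g * small_root a b g = a * g"
proof -
  have "big_root a b g * small_root a b g
      = ((a + b + g)\<^sup>2 - (sqrt ((a + b + g)\<^sup>2 - 4 * a * g))\<^sup>2) / 4"
    by (simp add: big_root_def small_root_def power2_eq_square algebra_simps)
  also have "(sqrt ((a + b + g)\<^sup>2 - 4 * a * g))\<^sup>2 = (a + b + g)\<^sup>2 - 4 * a * g"
    by (rule real_sqrt_pow2[OF disc_nonneg[OF assms]])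
  also have "((a + b + g)\<^sup>2 - ((a + b + g)\<^sup>2 - 4 * a * g)) / 4 = a * g" by simp
  finally show ?thesis .
qed

lemma roots_nonneg:
  assumes "0 \<le> a" "0 \<le> b" "0 \<le> g"
  shows "0 \<le> big_root a b g" "0 \<le> small_root a b g"
proof -
  show "0 \<le> big_root a b g"
    using assms disc_nonneg[OF assms] by (simp add: big_root_def)
  have "sqrt ((a + b + g)\<^sup>2 - 4 * a * g) \<le> sqrt ((a + b + g)\<^sup>2)"
    using assms by (intro real_sqrt_le_mono) simp
  then show "0 \<le> small_root a b g" using assms by (simp add: small_root_def)
qed

text \<open>By Vieta. The right side is the determinant of [[1 + t a, - sqrt (t b)],
  [sqrt (t b), 1 + t g]], the scalar case of the block determinant.\<close>

lemma roots_quadratic: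
  assumes "0 \<le> a" "0 \<le> b" "0 \<le> g"
  shows "(1 + t * big_root a b g) * (1 + t * small_root a b g) = (1 + t * a) * (1 + t * g) + t * b"
proof -
  have "(1 + t * big_root a b g) * (1 + t * small_root a b g)
      = 1 + t * (big_root a b g + small_root a b g) + t\<^sup>2 * (big_root a b g * small_root a b g)"
    by (simp add: power2_eq_square algebra_simps)
  then show ?thesis
    unfolding roots_sum roots_prod[OF assms] by (simp add: power2_eq_square algebra_simps)
qed

lemma ln_roots:
  assumes "0 \<le> a" "0 \<le> b" "0 \<le> g" "0 < t"
  shows "ln (1 + t * big_root a b g) + ln (1 + t * small_root a b g)
    = ln ((1 + t * a) * (1 + t * g) + t * b)"
proof -
  have "0 < 1 + t * big_root a b g" "0 < 1 + t * small_root a b g"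
    using roots_nonneg[OF assms(1-3)] assms(4) by (auto intro!: add_pos_nonneg)
  then show ?thesis by (simp add: ln_mult flip: roots_quadratic[OF assms(1-3)])
qed

lemma roots_no_coupling:
  assumes "0 \<le> a" "0 \<le> g"
  shows "(big_root a 0 g = a \<and> small_root a 0 g = g) \<or> (big_root a 0 g = g \<and> small_root a 0 g = a)"
proof -
  have "(a + 0 + g)\<^sup>2 - 4 * a * g = (a - g)\<^sup>2" by (simp add: power2_eq_square algebra_simps)
  then have "sqrt ((a + 0 + g)\<^sup>2 - 4 * a * g) = \<bar>a - g\<bar>" by simp
  then show ?thesis unfolding big_root_def small_root_def by (auto simp: abs_if field_simps)
qed

text \<open>When a + b + g = 1, this is the Shannon entropy of (a, b, g) minus that of the two
  roots, in nats.\<close>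

definition entropy_gap :: "real \<Rightarrow> real \<Rightarrow> real \<Rightarrow> real" where
  "entropy_gap a b g = big_root a b g * ln (big_root a b g) + small_root a b g * ln (small_root a b g)
     - a * ln a - b * ln b - g * ln g"

lemma entropy_gap_no_coupling:
  "0 \<le> a \<Longrightarrow> 0 \<le> g \<Longrightarrow> entropy_gap a 0 g = 0"
  using roots_no_coupling[of a g] by (auto simp: entropy_gap_def)

section \<open>Convexity of the coupling term and superadditivity\<close>

lemma softplus_convex: "convex_on UNIV (\<lambda>x::real. ln (1 + exp x))"
proof (rule convex_on_realI)
  show "((\<lambda>x. ln (1 + exp x)) has_real_derivative exp x / (1 + exp x)) (at x)" for x :: real
    by (auto intro!: derivative_eq_intros simp: add_pos_pos)
  show "exp x / (1 + exp x) \<le> exp y / (1 + exp y)" if "x \<le> y" for x y :: real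
  proof -
    have "0 < 1 + exp x" "0 < 1 + exp y" by (simp_all add: add_pos_pos)
    then show ?thesis using that by (simp add: divide_simps distrib_left mult.commute)
  qed
qed simp

text \<open>The function is softplus of ln c - ln p - ln q. The inner expression is convex in (p, q)
  because \<open>ln\<close> is concave, and softplus is increasing and convex, so the composition is
  convex.\<close>

lemma coupling_jensen:
  fixes p q p' q' u v c :: real
  assumes pos: "0 < p" "0 < q" "0 < p'" "0 < q'" "0 < c" and uv: "0 \<le> u" "0 \<le> v" "u + v = 1"
  shows "ln (1 + c / ((u * p + v * p') * (u * q + v * q')))
    \<le> u * ln (1 + c / (p * q)) + v * ln (1 + c / (p' * q'))"
proof -
  have mean: "0 < u * x + v * y" if "0 < x" "0 < y" for x y
    using uv that by (metis add_cancel_right_left add_nonneg_pos add_pos_nonneg less_eq_real_def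
        mult_nonneg_nonneg mult_pos_pos mult_zero_left zero_neq_one)
  have ln_mean: "u * ln x + v * ln y \<le> ln (u * x + v * y)" if "0 < x" "0 < y" for x y
  proof -
    have "u = 1 - v" using uv by simp
    then show ?thesis using concave_onD[OF ln_concave, of v x y] uv(1,2) that by simp
  qed
  let ?f = "\<lambda>x. ln (1 + exp x)"
  have form: "ln (1 + c / (x * y)) = ?f (ln c - ln x - ln y)" if "0 < x" "0 < y" for x y
    using that pos by (simp add: exp_diff)
  have "?f (ln c - ln (u * p + v * p') - ln (u * q + v * q'))
      \<le> ?f (u * (ln c - ln p - ln q) + v * (ln c - ln p' - ln q'))"
  proof -
    have "ln c = u * ln c + v * ln c" using uv by (simp add: distrib_right[symmetric])
    then have "ln c - ln (u * p + v * p') - ln (u * q + v * q')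
        \<le> u * (ln c - ln p - ln q) + v * (ln c - ln p' - ln q')"
      using ln_mean[of p p'] ln_mean[of q q'] pos by (simp add: algebra_simps)
    then show ?thesis by (simp add: add_pos_pos)
  qed
  also have "\<dots> \<le> u * ?f (ln c - ln p - ln q) + v * ?f (ln c - ln p' - ln q')"
  proof -
    have "u = 1 - v" using uv by simp
    then show ?thesis
      using convex_onD[OF softplus_convex, of v "ln c - ln p - ln q" "ln c - ln p' - ln q'"] uv(1,2) by simp
  qed
  finally show ?thesis using pos mean by (simp add: form)
qed

text \<open>Rescaling a triple by \<open>1 / b\<close> turns its coupling term into \<open>t\<close>, independently of the
  triple, so that Jensen's inequality applies with weights \<open>b\<close>.\<close>

definition gap_terms :: "real \<Rightarrow> real \<Rightarrow> real \<Rightarrow> real \<Rightarrow> (real \<times> real) list" where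
  "gap_terms s a b g = [(s * b, big_root a b g / b), (s * b, small_root a b g / b),
     (- (s * b), a / b), (- (s * b), g / b)]"

lemma gap_terms_nonneg:
  "0 \<le> a \<Longrightarrow> 0 < b \<Longrightarrow> 0 \<le> g \<Longrightarrow> (c, x) \<in> set (gap_terms s a b g) \<Longrightarrow> 0 \<le> x"
  using roots_nonneg[of a b g] by (auto simp: gap_terms_def)

text \<open>The value depends on the triple only through \<open>b\<close>, so a signed combination
  of triples meets the sum condition of the entropy comparison as soon as the coupling terms
  balance.\<close>

lemma gap_terms_sum:
  assumes "0 < b"
  shows "(\<Sum>(c, x)\<leftarrow>gap_terms s a b g. c * x) = s * b"
proof -
  have "(\<Sum>(c, x)\<leftarrow>gap_terms s a b g. c * x) = s * (big_root a b g + small_root a b g - a - g)"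
    using assms by (simp add: gap_terms_def algebra_simps)
  then show ?thesis by (simp add: roots_sum)
qed

lemma gap_terms_log:
  assumes "0 \<le> a" "0 < b" "0 \<le> g" "0 < t"
  shows "(\<Sum>(c, x)\<leftarrow>gap_terms s a b g. c * ln (1 + t * x))
    = s * b * ln (1 + t / ((1 + t * (a / b)) * (1 + t * (g / b))))"
proof -
  have p: "0 < 1 + t * (a / b)" "0 < 1 + t * (g / b)" using assms by (auto intro!: add_pos_nonneg)
  have "ln (1 + t * (big_root a b g / b)) + ln (1 + t * (small_root a b g / b))
      = ln ((1 + t * (a / b)) * (1 + t * (g / b)) + t)"
    using ln_roots[of a b g "t / b"] assms by simp
  also have "(1 + t * (a / b)) * (1 + t * (g / b)) + t
      = (1 + t * (a / b)) * (1 + t * (g / b)) * (1 + t / ((1 + t * (a / b)) * (1 + t * (g / b))))"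
  proof -
    have "P + t = P * (1 + t / P)" if "0 < P" for P using that by (simp add: field_simps)
    then show ?thesis using p by simp
  qed
  also have "ln \<dots> = ln (1 + t * (a / b)) + ln (1 + t * (g / b))
      + ln (1 + t / ((1 + t * (a / b)) * (1 + t * (g / b))))"
  proof -
    have "0 < 1 + t / ((1 + t * (a / b)) * (1 + t * (g / b)))"
      using divide_pos_pos[OF assms(4) mult_pos_pos[OF p]] by linarith
    moreover have "ln (x * y * z) = ln x + ln y + ln z" if "0 < x" "0 < y" "0 < z" for x y z :: real
      using that by (simp add: ln_mult)
    ultimately show ?thesis using p by blast
  qed
  finally have sum_ln: "ln (1 + t * (big_root a b g / b)) + ln (1 + t * (small_root a b g / b))
    = ln (1 + t * (a / b)) + ln (1 + t * (g / b)) + ln (1 + t / ((1 + t * (a / b)) * (1 + t * (g / b))))" .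
  have "s * b * x + (s * b * y + (- (s * b) * z + - (s * b) * w)) = s * b * k"
    if "x + y = z + w + k" for x y z w k
  proof -
    from that have k: "k = x + y - z - w" by simp
    show ?thesis unfolding k by (simp add: algebra_simps)
  qed
  from this[OF sum_ln] show ?thesis by (simp add: gap_terms_def)
qed

text \<open>The summand - b ln b of \<open>entropy_gap\<close> has no entry in
  \<open>gap_terms\<close>; the rescaling produces it, because the factors ln b carry total weight R
  + r - a - g = b, where R and r are the roots.\<close>

lemma gap_terms_xlnx:
  assumes "0 \<le> a" "0 < b" "0 \<le> g"
  shows "(\<Sum>(c, x)\<leftarrow>gap_terms s a b g. c * (x * ln x)) = s * entropy_gap a b g"
proof -
  have scale: "b * (x / b * ln (x / b)) = x * ln x - x * ln b" if "0 \<le> x" for x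
    using that assms by (cases "x = 0") (auto simp: ln_div algebra_simps)
  note r = roots_nonneg[of a b g]
  have "(\<Sum>(c, x)\<leftarrow>gap_terms s a b g. c * (x * ln x))
      = s * (b * (big_root a b g / b * ln (big_root a b g / b))
        + b * (small_root a b g / b * ln (small_root a b g / b))
        - b * (a / b * ln (a / b)) - b * (g / b * ln (g / b)))"
    by (simp add: gap_terms_def algebra_simps)
  also have "\<dots> = s * (entropy_gap a b g + (b + a + g - (big_root a b g + small_root a b g)) * ln b)"
    unfolding scale[OF r(1)[OF assms(1) less_imp_le[OF assms(2)] assms(3)]]
      scale[OF r(2)[OF assms(1) less_imp_le[OF assms(2)] assms(3)]] scale[OF assms(1)] scale[OF assms(3)]
    by (simp add: entropy_gap_def algebra_simps)
  finally show ?thesis by (simp add: roots_sum)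
qed

text \<open>Supplies superadditivity when one triple has coupling 0 and cannot be rescaled by 1 / b:
  such a triple only enlarges \<open>a\<close> and \<open>g\<close> of the other. For b > 0 the
  coupling logarithm decreases in both.\<close>

lemma entropy_gap_mono:
  assumes "0 \<le> a" "0 \<le> b" "0 \<le> g" "a \<le> a'" "g \<le> g'"
  shows "entropy_gap a b g \<le> entropy_gap a' b g'"
proof (cases "b = 0")
  case True
  then show ?thesis using assms by (simp add: entropy_gap_no_coupling)
next
  case False
  then have b: "0 < b" using assms by simp
  have "(\<Sum>(c, x)\<leftarrow>gap_terms 1 a b g @ gap_terms (-1) a' b g'. c * (x * ln x)) \<le> 0"
  proof (rule weighted_entropy_from_log_det)
    show "0 \<le> x" if "(c, x) \<in> set (gap_terms 1 a b g @ gap_terms (-1) a' b g')" for c x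
      using that assms b gap_terms_nonneg[of a b g c x 1] gap_terms_nonneg[of a' b g' c x "-1"] by auto
    show "(\<Sum>(c, x)\<leftarrow>gap_terms 1 a b g @ gap_terms (-1) a' b g'. c * x) = 0"
      using b by (simp add: gap_terms_sum)
    fix t :: real assume t: "0 < t"
    have "ln (1 + t / ((1 + t * (a' / b)) * (1 + t * (g' / b))))
        \<le> ln (1 + t / ((1 + t * (a / b)) * (1 + t * (g / b))))"
      using assms b t
      by (intro ln_mono add_left_mono divide_left_mono mult_mono add_mono divide_right_mono
          mult_pos_pos add_pos_nonneg mult_nonneg_nonneg) (auto intro!: add_pos_nonneg add_nonneg_nonneg)
    then show "0 \<le> (\<Sum>(c, x)\<leftarrow>gap_terms 1 a b g @ gap_terms (-1) a' b g'. c * ln (1 + t * x))"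
      using assms b t by (simp add: gap_terms_log)
  qed
  then show ?thesis using assms b by (simp add: gap_terms_xlnx)
qed

lemma entropy_gap_superadditive:
  assumes nn: "0 \<le> a" "0 \<le> b" "0 \<le> g" "0 \<le> a'" "0 \<le> b'" "0 \<le> g'"
  shows "entropy_gap a b g + entropy_gap a' b' g' \<le> entropy_gap (a + a') (b + b') (g + g')"
proof -
  consider "b = 0" | "b' = 0" | "0 < b" "0 < b'" using nn by fastforce
  then show ?thesis
  proof cases
    case 1
    then show ?thesis using nn entropy_gap_mono[of a' b' g' "a + a'" "g + g'"]
      by (simp add: entropy_gap_no_coupling)
  next
    case 2
    then show ?thesis using nn entropy_gap_mono[of a b g "a + a'" "g + g'"]
      by (simp add: entropy_gap_no_coupling)
  next
    case 3
    let ?B = "b + b'"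
    let ?L = "gap_terms 1 a b g @ gap_terms 1 a' b' g' @ gap_terms (-1) (a + a') ?B (g + g')"
    have "(\<Sum>(c, x)\<leftarrow>?L. c * (x * ln x)) \<le> 0"
    proof (rule weighted_entropy_from_log_det)
      show "0 \<le> x" if "(c, x) \<in> set ?L" for c x
        using that nn 3 gap_terms_nonneg[of a b g c x 1] gap_terms_nonneg[of a' b' g' c x 1]
          gap_terms_nonneg[of "a + a'" ?B "g + g'" c x "-1"] by auto
      show "(\<Sum>(c, x)\<leftarrow>?L. c * x) = 0"
        using 3 by (simp add: gap_terms_sum)
      fix t :: real assume t: "0 < t"
      \<comment> \<open>With these weights the rescaled entries of the summed triple are the means
        of the rescaled entries of the two triples, which is the form that
        \<open>coupling_jensen\<close> takes.\<close>
      define u v where "u = b / ?B" and "v = b' / ?B"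
      have uv: "0 \<le> u" "0 \<le> v" "u + v = 1" using 3 by (auto simp: u_def v_def add_divide_distrib[symmetric])
      have mean: "1 + t * ((x + x') / ?B) = u * (1 + t * (x / b)) + v * (1 + t * (x' / b'))" for x x'
      proof -
        have "u * (1 + t * (x / b)) + v * (1 + t * (x' / b')) = (u + v) + t * (u * (x / b) + v * (x' / b'))"
          by (simp add: algebra_simps)
        also have "u * (x / b) + v * (x' / b') = (x + x') / ?B"
          using 3 by (simp add: u_def v_def add_divide_distrib)
        finally show ?thesis using uv by simp
      qed
      have "ln (1 + t / ((1 + t * ((a + a') / ?B)) * (1 + t * ((g + g') / ?B))))
          \<le> u * ln (1 + t / ((1 + t * (a / b)) * (1 + t * (g / b))))
            + v * ln (1 + t / ((1 + t * (a' / b')) * (1 + t * (g' / b'))))"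
        unfolding mean using nn 3 t uv by (intro coupling_jensen) (auto intro!: add_pos_nonneg)
      then have "?B * ln (1 + t / ((1 + t * ((a + a') / ?B)) * (1 + t * ((g + g') / ?B))))
          \<le> ?B * (u * ln (1 + t / ((1 + t * (a / b)) * (1 + t * (g / b))))
            + v * ln (1 + t / ((1 + t * (a' / b')) * (1 + t * (g' / b')))))"
        using 3 by (intro mult_left_mono) auto
      also have "\<dots> = b * ln (1 + t / ((1 + t * (a / b)) * (1 + t * (g / b))))
            + b' * ln (1 + t / ((1 + t * (a' / b')) * (1 + t * (g' / b'))))"
        using 3 by (simp add: u_def v_def distrib_left)
      finally show "0 \<le> (\<Sum>(c, x)\<leftarrow>?L. c * ln (1 + t * x))"
        using nn 3 t by (simp add: gap_terms_log left_diff_distrib distrib_right)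
    qed
    then show ?thesis using nn 3 by (simp add: gap_terms_xlnx)
  qed
qed

lemma entropy_gap_sum:
  assumes "finite I" "\<And>j. j \<in> I \<Longrightarrow> 0 \<le> a j" "\<And>j. j \<in> I \<Longrightarrow> 0 \<le> b j" "\<And>j. j \<in> I \<Longrightarrow> 0 \<le> g j"
  shows "(\<Sum>j\<in>I. entropy_gap (a j) (b j) (g j)) \<le> entropy_gap (\<Sum>j\<in>I. a j) (\<Sum>j\<in>I. b j) (\<Sum>j\<in>I. g j)"
  using assms
proof (induction I rule: finite_induct)
  case empty
  then show ?case by (simp add: entropy_gap_no_coupling)
next
  case (insert i I)
  then show ?case
    using entropy_gap_superadditive[of "a i" "b i" "g i" "\<Sum>j\<in>I. a j" "\<Sum>j\<in>I. b j" "\<Sum>j\<in>I. g j"]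
    by (simp add: sum_nonneg)
qed

section \<open>Adjoints and Schur complements\<close>

lemma adj_index:
  fixes A :: "complex mat"
  shows "i < dim_col A \<Longrightarrow> j < dim_row A \<Longrightarrow> mat_adjoint A $$ (i, j) = cnj (A $$ (j, i))"
  unfolding mat_adjoint_def by (simp add: mat_of_rows_index)

lemma adj_dim [simp]:
  fixes A :: "complex mat"
  shows "dim_row (mat_adjoint A) = dim_col A" "dim_col (mat_adjoint A) = dim_row A"
  unfolding mat_adjoint_def by simp_all

lemma adj_adj [simp]: "mat_adjoint (mat_adjoint A) = (A :: complex mat)"
  by (rule eq_matI) (auto simp: adj_index)

lemma mult_index:
  fixes A B :: "complex mat"
  shows "A \<in> carrier_mat m n \<Longrightarrow> B \<in> carrier_mat n k \<Longrightarrow> i < m \<Longrightarrow> j < k \<Longrightarrow>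
    (A * B) $$ (i, j) = (\<Sum>l<n. A $$ (i, l) * B $$ (l, j))"
  by (auto simp: scalar_prod_def lessThan_atLeast0 intro!: sum.cong)

lemma adj_mult:
  fixes A B :: "complex mat"
  assumes A: "A \<in> carrier_mat m n" and B: "B \<in> carrier_mat n k"
  shows "mat_adjoint (A * B) = mat_adjoint B * mat_adjoint A"
proof (rule eq_matI)
  fix i j assume "i < dim_row (mat_adjoint B * mat_adjoint A)" "j < dim_col (mat_adjoint B * mat_adjoint A)"
  then have ij: "i < k" "j < m" using A B by auto
  then have "mat_adjoint (A * B) $$ (i, j) = cnj (\<Sum>l<n. A $$ (j, l) * B $$ (l, i))"
    using A B by (simp add: adj_index flip: mult_index[OF A B])
  also have "\<dots> = (\<Sum>l<n. mat_adjoint B $$ (i, l) * mat_adjoint A $$ (l, j))"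
    using A B ij by (auto simp: adj_index mult.commute intro!: sum.cong)
  also have "\<dots> = (mat_adjoint B * mat_adjoint A) $$ (i, j)"
    using A B ij by (subst mult_index[of _ k n _ m]) auto
  finally show "mat_adjoint (A * B) $$ (i, j) = (mat_adjoint B * mat_adjoint A) $$ (i, j)" .
qed (use A B in auto)

lemma adj_four_block:
  fixes A B C D :: "complex mat"
  assumes "A \<in> carrier_mat n1 m1" "B \<in> carrier_mat n1 m2" "C \<in> carrier_mat n2 m1" "D \<in> carrier_mat n2 m2"
  shows "mat_adjoint (four_block_mat A B C D)
    = four_block_mat (mat_adjoint A) (mat_adjoint C) (mat_adjoint B) (mat_adjoint D)"
  using assms by (intro eq_matI) (auto simp: adj_index)

lemma adj_zero [simp]: "mat_adjoint (0\<^sub>m n m) = (0\<^sub>m m n :: complex mat)"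
  by (rule eq_matI) (auto simp: adj_index)

lemma adj_one [simp]: "mat_adjoint (1\<^sub>m n) = (1\<^sub>m n :: complex mat)"
  by (rule eq_matI) (auto simp: adj_index)

lemma adj_diag: "mat_adjoint (mat_diag n d) = (mat_diag n (\<lambda>i. cnj (d i)) :: complex mat)"
  by (rule eq_matI) (auto simp: adj_index mat_diag_def)

text \<open>\<open>U\<close> stands for the inverse of \<open>D\<close> applied to \<open>C\<close>.
  Multiplication from the right by a unit lower triangular matrix clears the lower left
  block.\<close>

lemma det_schur_complement:
  fixes A B C D :: "complex mat"
  assumes A: "A \<in> carrier_mat n n" and B: "B \<in> carrier_mat n m" and C: "C \<in> carrier_mat m n"
    and D: "D \<in> carrier_mat m m" and U: "U \<in> carrier_mat m n" and DU: "D * U = C"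
  shows "det (four_block_mat A B C D) = det (A - B * U) * det D"
proof -
  let ?E = "four_block_mat (1\<^sub>m n) (0\<^sub>m n m) (- U) (1\<^sub>m m)"
  have BU: "B * U \<in> carrier_mat n n" using B U by simp
  have blocks: "A * 1\<^sub>m n + B * - U = A - B * U" "C * 1\<^sub>m n + D * - U = 0\<^sub>m m n"
      "A * 0\<^sub>m n m + B * 1\<^sub>m m = B" "C * 0\<^sub>m n m + D * 1\<^sub>m m = D"
    unfolding DU[symmetric] using A B D U by (auto intro!: eq_matI)
  have eq: "four_block_mat A B C D * ?E = four_block_mat (A - B * U) B (0\<^sub>m m n) D"
    unfolding mult_four_block_mat[OF A B C D one_carrier_mat zero_carrier_mat uminus_carrier_mat[OF U] one_carrier_mat]
      blocks ..
  have "det (four_block_mat A B C D * ?E) = det (four_block_mat A B C D) * det ?E"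
    by (rule det_mult[OF four_block_carrier_mat[OF A D] four_block_carrier_mat[OF one_carrier_mat one_carrier_mat]])
  moreover have "det ?E = 1"
    using det_four_block_mat_upper_right_zero[OF one_carrier_mat refl uminus_carrier_mat[OF U] one_carrier_mat] by simp
  moreover have "det (four_block_mat (A - B * U) B (0\<^sub>m m n) D) = det (A - B * U) * det D"
    by (rule det_four_block_mat_lower_left_zero[OF minus_carrier_mat[OF BU] B refl D])
  ultimately show ?thesis using eq by simp
qed

text \<open>Sylvester's identity: the determinant of \<open>?M\<close> is computed twice, once by
  eliminating \<open>Q\<close> and once by eliminating \<open>- P\<close>.\<close>

lemma det_one_plus_commute:
  fixes P Q :: "complex mat"
  assumes P: "P \<in> carrier_mat m n" and Q: "Q \<in> carrier_mat n m"
  shows "det (1\<^sub>m m + P * Q) = det (1\<^sub>m n + Q * P)"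
proof -
  let ?M = "four_block_mat (1\<^sub>m m) (- P) Q (1\<^sub>m n)"
  let ?E = "four_block_mat (1\<^sub>m m) P (0\<^sub>m n m) (1\<^sub>m n)"
  have PQ: "P * Q \<in> carrier_mat m m" "Q * P \<in> carrier_mat n n" using P Q by simp_all
  have nP: "- P \<in> carrier_mat m n" using P by simp
  have "1\<^sub>m n * Q = Q" using Q by simp
  from det_schur_complement[OF one_carrier_mat nP Q one_carrier_mat Q this]
  have "det ?M = det (1\<^sub>m m - (- P) * Q)" by simp
  also have "1\<^sub>m m - (- P) * Q = 1\<^sub>m m + P * Q" using P Q by (auto intro!: eq_matI)
  finally have 1: "det ?M = det (1\<^sub>m m + P * Q)" .
  have blocks: "1\<^sub>m m * 1\<^sub>m m + - P * 0\<^sub>m n m = 1\<^sub>m m" "1\<^sub>m m * P + - P * 1\<^sub>m n = 0\<^sub>m m n"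
      "Q * 1\<^sub>m m + 1\<^sub>m n * 0\<^sub>m n m = Q" "Q * P + 1\<^sub>m n * 1\<^sub>m n = 1\<^sub>m n + Q * P"
    using P Q by (auto intro!: eq_matI)
  have eq: "?M * ?E = four_block_mat (1\<^sub>m m) (0\<^sub>m m n) Q (1\<^sub>m n + Q * P)"
    unfolding mult_four_block_mat[OF one_carrier_mat nP Q one_carrier_mat one_carrier_mat P zero_carrier_mat one_carrier_mat]
      blocks ..
  have "det (?M * ?E) = det ?M * det ?E"
    by (rule det_mult[OF four_block_carrier_mat[OF one_carrier_mat one_carrier_mat] four_block_carrier_mat[OF one_carrier_mat one_carrier_mat]])
  moreover have "det ?E = 1"
    using det_four_block_mat_lower_left_zero[OF one_carrier_mat P refl one_carrier_mat] by simp
  moreover have "det (?M * ?E) = det (1\<^sub>m n + Q * P)"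
    unfolding eq
    using det_four_block_mat_upper_right_zero[OF one_carrier_mat refl Q, of "1\<^sub>m n + Q * P"] PQ by simp
  ultimately show ?thesis using 1 by simp
qed

section \<open>Pinching inequalities for determinants\<close>

lemma linear_system_solvable:
  fixes f :: "nat \<Rightarrow> nat \<Rightarrow> complex"
  assumes "\<And>u. (\<And>i. i < n \<Longrightarrow> (\<Sum>j<n. f i j * u j) = 0) \<Longrightarrow> (\<And>j. j < n \<Longrightarrow> u j = 0)"
  shows "det (mat n n (\<lambda>(i, j). f i j)) \<noteq> 0" "\<exists>u. \<forall>i<n. (\<Sum>j<n. f i j * u j) = c i"
proof -
  let ?M = "mat n n (\<lambda>(i, j). f i j)"
  have M: "?M \<in> carrier_mat n n" by simp
  show nz: "det ?M \<noteq> 0"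
  proof
    assume "det ?M = 0"
    then obtain v where v: "v \<in> carrier_vec n" "v \<noteq> 0\<^sub>v n" "?M *\<^sub>v v = 0\<^sub>v n"
      using det_0_iff_vec_prod_zero_field[OF M] by blast
    have "(\<Sum>j<n. f i j * v $ j) = (?M *\<^sub>v v) $ i" if "i < n" for i
      using that v(1) by (auto simp: scalar_prod_def lessThan_atLeast0 intro!: sum.cong)
    then have sum0: "(\<Sum>j<n. f i j * v $ j) = 0" if "i < n" for i using v(3) that by simp
    have "v $ j = 0" if "j < n" for j
      by (rule assms[of "\<lambda>j. v $ j", OF sum0 that])
    then have "v = 0\<^sub>v n" using v(1) by (intro eq_vecI) auto
    with v(2) show False by simp
  qed
  \<comment> \<open>Cramer's rule: the adjugate divided by the determinant is the inverse.\<close>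
  define u where "u = (1 / det ?M) \<cdot>\<^sub>v (adj_mat ?M *\<^sub>v vec n c)"
  note adj = adj_mat[OF M]
  have u: "u \<in> carrier_vec n" using adj(1) by (simp add: u_def)
  have "?M *\<^sub>v u = (1 / det ?M) \<cdot>\<^sub>v ((?M * adj_mat ?M) *\<^sub>v vec n c)"
    using M adj(1) by (simp add: u_def mult_mat_vec[of _ n n] assoc_mult_mat_vec[of _ n n _ n])
  also have "\<dots> = vec n c"
    using nz by (auto simp: adj(2) intro!: eq_vecI)
  finally have "?M *\<^sub>v u = vec n c" .
  moreover have "(\<Sum>j<n. f i j * u $ j) = (?M *\<^sub>v u) $ i" if "i < n" for i
    using that u by (auto simp: scalar_prod_def lessThan_atLeast0 intro!: sum.cong)
  ultimately have "\<forall>i<n. (\<Sum>j<n. f i j * u $ j) = c i" by simp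
  then show "\<exists>u. \<forall>i<n. (\<Sum>j<n. f i j * u j) = c i" by blast
qed

text \<open>Subtracting from the last column the combination of the others with coefficients
  \<open>u\<close> clears it above the corner, where the Schur complement remains. This is the
  induction step over leading minors.\<close>

lemma det_bordered:
  fixes f :: "nat \<Rightarrow> nat \<Rightarrow> complex"
  assumes u: "\<And>i. i < n \<Longrightarrow> (\<Sum>j<n. f i j * u j) = f i n"
  shows "det (mat (Suc n) (Suc n) (\<lambda>(i, j). f i j))
    = (f n n - (\<Sum>j<n. f n j * u j)) * det (mat n n (\<lambda>(i, j). f i j))"
proof -
  let ?M = "mat (Suc n) (Suc n) (\<lambda>(i, j). f i j)"
  let ?E = "mat (Suc n) (Suc n) (\<lambda>(i, j). if i = j then 1 else if j = n then - u i else 0)"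
  let ?N = "four_block_mat (mat n n (\<lambda>(i, j). f i j)) (0\<^sub>m n 1) (mat 1 n (\<lambda>(i, j). f n j))
    (mat 1 1 (\<lambda>_. f n n - (\<Sum>j<n. f n j * u j)))"
  have "?M * ?E = ?N"
  proof (rule eq_matI)
    fix i j assume "i < dim_row ?N" "j < dim_col ?N"
    then have ij: "i < Suc n" "j < Suc n" by auto
    have "(?M * ?E) $$ (i, j) = (\<Sum>l<Suc n. f i l * (if l = j then 1 else if j = n then - u l else 0))"
      using ij by (subst mult_index[of _ "Suc n" "Suc n" _ "Suc n"]) auto
    also have "\<dots> = (if j = n then f i n - (\<Sum>l<n. f i l * u l) else f i j)"
    proof (cases "j = n")
      case True
      then show ?thesis by (simp add: sum_negf)
    next
      case False
      then have "j < n" using ij by simp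
      then have "(\<Sum>l<Suc n. f i l * (if l = j then 1 else if j = n then - u l else 0))
          = (\<Sum>l<Suc n. if l = j then f i l else 0)"
        by (intro sum.cong) auto
      then show ?thesis using ij False by simp
    qed
    also have "\<dots> = ?N $$ (i, j)"
      using ij u by (auto simp: less_Suc_eq)
    finally show "(?M * ?E) $$ (i, j) = ?N $$ (i, j)" .
  qed auto
  moreover have "det (?M * ?E) = det ?M * det ?E"
    by (rule det_mult[of _ "Suc n"]) auto
  moreover have "det ?E = 1"
  proof -
    have "det ?E = prod_list (diag_mat ?E)"
      by (rule det_upper_triangular[of _ "Suc n"]) (auto simp: upper_triangular_def)
    also have "diag_mat ?E = map (\<lambda>_. 1) [0..<Suc n]"
      by (auto simp: diag_mat_def intro!: map_cong)
    finally show ?thesis by (simp add: map_replicate_const)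
  qed
  moreover have "det ?N = det (mat n n (\<lambda>(i, j). f i j)) * (f n n - (\<Sum>j<n. f n j * u j))"
    by (subst det_four_block_mat_upper_right_zero_col[of _ n]) (auto simp: det_single)
  ultimately show ?thesis by simp
qed

section \<open>Gram matrices with an imaginary diagonal shift\<close>

definition cinner :: "nat \<Rightarrow> (nat \<Rightarrow> complex) \<Rightarrow> (nat \<Rightarrow> complex) \<Rightarrow> complex" where
  "cinner m x y = (\<Sum>k<m. cnj (x k) * y k)"

definition cnorm2 :: "nat \<Rightarrow> (nat \<Rightarrow> complex) \<Rightarrow> real" where
  "cnorm2 m x = (\<Sum>k<m. (cmod (x k))\<^sup>2)"

lemma cinner_self: "cinner m x x = of_real (cnorm2 m x)"
  by (simp add: cinner_def cnorm2_def mult.commute flip: complex_norm_square)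

lemma cnorm2_nonneg: "0 \<le> cnorm2 m x"
  by (simp add: cnorm2_def sum_nonneg)

lemma cnorm2_eq_0: "cnorm2 m x = 0 \<Longrightarrow> k < m \<Longrightarrow> x k = 0"
  by (auto simp: cnorm2_def sum_nonneg_eq_0_iff)

lemma cinner_commute: "cnj (cinner m x y) = cinner m y x"
  by (simp add: cinner_def mult.commute)

lemma cinner_sum_right: "cinner m x (\<lambda>k. \<Sum>j\<in>I. u j * y j k) = (\<Sum>j\<in>I. u j * cinner m x (y j))"
  unfolding cinner_def sum_distrib_left by (subst sum.swap) (simp add: algebra_simps)

lemma cinner_sum_left: "cinner m (\<lambda>k. \<Sum>j\<in>I. u j * y j k) x = (\<Sum>j\<in>I. cnj (u j) * cinner m (y j) x)"
  unfolding cinner_def cnj_sum sum_distrib_left sum_distrib_right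
  by (subst sum.swap) (simp add: algebra_simps)

lemma cinner_Cauchy_Schwarz: "(cmod (cinner m x y))\<^sup>2 \<le> cnorm2 m x * cnorm2 m y"
proof -
  have "cmod (cinner m x y) \<le> (\<Sum>k<m. cmod (x k) * cmod (y k))"
    unfolding cinner_def by (rule order_trans[OF norm_sum]) (simp add: norm_mult)
  then have "(cmod (cinner m x y))\<^sup>2 \<le> (\<Sum>k<m. cmod (x k) * cmod (y k))\<^sup>2"
    by (simp add: power_mono)
  also have "\<dots> \<le> cnorm2 m x * cnorm2 m y"
    unfolding cnorm2_def by (rule Cauchy_Schwarz_ineq_sum)
  finally show ?thesis .
qed

definition independent_upto :: "nat \<Rightarrow> nat \<Rightarrow> (nat \<Rightarrow> nat \<Rightarrow> complex) \<Rightarrow> bool" where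
  "independent_upto m n G \<longleftrightarrow>
    (\<forall>u. (\<forall>k<m. (\<Sum>j<n. u j * G j k) = 0) \<longrightarrow> (\<forall>j<n. u j = 0))"

lemma independent_uptoD:
  assumes "independent_upto m n G" "\<And>k. k < m \<Longrightarrow> (\<Sum>j<n. u j * G j k) = 0" "j < n"
  shows "u j = 0"
  using assms unfolding independent_upto_def by blast

lemma independent_upto_Suc:
  assumes "independent_upto m (Suc n) G"
  shows "independent_upto m n G"
  unfolding independent_upto_def
proof (intro allI impI)
  fix u j assume u: "\<forall>k<m. (\<Sum>j<n. u j * G j k) = 0" and j: "j < n"
  let ?v = "\<lambda>j. if j < n then u j else 0"
  have "(\<Sum>j<Suc n. ?v j * G j k) = (\<Sum>j<n. u j * G j k)" for k by simp
  then have "(\<Sum>j<Suc n. ?v j * G j k) = 0" if "k < m" for k using u that by metis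
  from independent_uptoD[of m "Suc n" G ?v j, OF assms this] show "u j = 0" using j by simp
qed

abbreviation shifted_gram :: "nat \<Rightarrow> (nat \<Rightarrow> nat \<Rightarrow> complex) \<Rightarrow> (nat \<Rightarrow> real) \<Rightarrow> nat \<Rightarrow> nat \<Rightarrow> complex" where
  "shifted_gram m G \<kappa> i j \<equiv> cinner m (G i) (G j) + (if i = j then \<i> * of_real (\<kappa> i) else 0)"

lemma shifted_gram_row:
  assumes "i < n"
  shows "(\<Sum>j<n. shifted_gram m G \<kappa> i j * u j)
    = cinner m (G i) (\<lambda>k. \<Sum>j<n. u j * G j k) + \<i> * of_real (\<kappa> i) * u i"
proof -
  have "(\<Sum>j<n. shifted_gram m G \<kappa> i j * u j)
      = (\<Sum>j<n. u j * cinner m (G i) (G j)) + (\<Sum>j<n. if i = j then \<i> * of_real (\<kappa> j) * u j else 0)"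
    unfolding sum.distrib[symmetric] by (intro sum.cong refl) (simp add: distrib_right)
  then show ?thesis using assms by (simp add: cinner_sum_right)
qed

text \<open>The equations are paired with \<open>u\<close>: the Gram part contributes a squared
  norm, the shift a purely imaginary number. With z = 0 the real part gives injectivity; with z =
  \<open>G n\<close> the two parts are the numbers \<open>p\<close> and \<open>r\<close> of the
  bordered estimate.\<close>

lemma shifted_gram_quadratic:
  fixes u :: "nat \<Rightarrow> complex"
  assumes "\<And>i. i < n \<Longrightarrow> cinner m (G i) (\<lambda>k. \<Sum>j<n. u j * G j k) + \<i> * of_real (\<kappa> i) * u i = cinner m (G i) z"
  shows "cinner m (\<lambda>k. \<Sum>j<n. u j * G j k) z
    = of_real (cnorm2 m (\<lambda>k. \<Sum>j<n. u j * G j k)) + \<i> * of_real (\<Sum>i<n. \<kappa> i * (cmod (u i))\<^sup>2)"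
proof -
  let ?y = "\<lambda>k. \<Sum>j<n. u j * G j k"
  have "cinner m ?y z = (\<Sum>i<n. cnj (u i) * cinner m (G i) z)" by (rule cinner_sum_left)
  also have "\<dots> = (\<Sum>i<n. cnj (u i) * (cinner m (G i) ?y + \<i> * of_real (\<kappa> i) * u i))"
    using assms by (intro sum.cong) auto
  also have "\<dots> = (\<Sum>i<n. cnj (u i) * cinner m (G i) ?y) + (\<Sum>i<n. \<i> * of_real (\<kappa> i * (cmod (u i))\<^sup>2))"
    unfolding sum.distrib[symmetric] of_real_mult complex_norm_square by (intro sum.cong) (auto simp: algebra_simps)
  also have "(\<Sum>i<n. cnj (u i) * cinner m (G i) ?y) = cinner m ?y ?y" by (rule cinner_sum_left[symmetric])
  finally show ?thesis by (simp add: cinner_self sum_distrib_left)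
qed

lemma shifted_gram_kernel:
  assumes indep: "independent_upto m n G"
    and zero: "\<And>i. i < n \<Longrightarrow> (\<Sum>j<n. shifted_gram m G \<kappa> i j * u j) = 0" and j: "j < n"
  shows "u j = 0"
proof -
  have "cinner m (\<lambda>k. \<Sum>j<n. u j * G j k) (\<lambda>_. 0)
    = of_real (cnorm2 m (\<lambda>k. \<Sum>j<n. u j * G j k)) + \<i> * of_real (\<Sum>i<n. \<kappa> i * (cmod (u i))\<^sup>2)"
  proof (rule shifted_gram_quadratic)
    fix i assume i: "i < n"
    have "cinner m (G i) (\<lambda>_. 0) = 0" by (simp add: cinner_def)
    with zero[OF i] show "cinner m (G i) (\<lambda>k. \<Sum>j<n. u j * G j k) + \<i> * of_real (\<kappa> i) * u i
        = cinner m (G i) (\<lambda>_. 0)"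
      unfolding shifted_gram_row[OF i] by simp
  qed
  then have "cnorm2 m (\<lambda>k. \<Sum>j<n. u j * G j k) = 0"
    by (simp add: cinner_def complex_eq_iff)
  then have "(\<Sum>j<n. u j * G j k) = 0" if "k < m" for k using cnorm2_eq_0[OF _ that] by blast
  from independent_uptoD[OF indep this j] show ?thesis .
qed

text \<open>Here \<open>h\<close> is the squared norm of the border vector and \<open>c\<close> that
  of its projection onto the earlier vectors. The last Schur complements are h - c without the shift
  and (h - p) + i (\<kappa> + r) with it, and the claim compares their moduli relative to the
  diagonal entries h and h + i \<kappa>.\<close>

lemma bordered_scalar_bound:
  fixes h c p r \<kappa> :: real
  assumes c: "0 \<le> c" "c < h" and p: "0 \<le> p" and pr: "p\<^sup>2 + r\<^sup>2 \<le> c * p"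
  shows "(h - c)\<^sup>2 * (h\<^sup>2 + \<kappa>\<^sup>2) \<le> h\<^sup>2 * ((h - p)\<^sup>2 + (\<kappa> + r)\<^sup>2)"
proof (cases "c = 0")
  case True
  then have "p = 0" "r = 0" using pr by (auto simp: sum_power2_le_zero_iff)
  then show ?thesis using True by simp
next
  case False
  have "p\<^sup>2 \<le> c * p" using pr zero_le_power2[of r] by linarith
  then have pc: "p \<le> c" using p c by (cases "p = 0") (auto simp: power2_eq_square)
  \<comment> \<open>The coefficient of \<open>\<kappa>\<^sup>2\<close> in the difference of the two
    sides. Multiplying the difference by \<open>A\<close> completes the square in \<kappa>, so the
    bound holds for all real \<kappa> once the constant remainder is nonnegative.\<close>
  define A where "A = h\<^sup>2 - (h - c)\<^sup>2"
  have A: "A = c * (2 * h - c)" by (simp add: A_def power2_eq_square algebra_simps)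
  have A0: "0 < A" using False c by (simp add: A)
  \<comment> \<open>The remainder left by the completed square. Both sides contain c - p: the right
    one because \<open>(h - p)\<^sup>2 - (h - c)\<^sup>2\<close> is (c - p) (2 h - c - p), the left
    one through \<open>pr\<close>.\<close>
  have key: "r\<^sup>2 * (h - c)\<^sup>2 \<le> ((h - p)\<^sup>2 - (h - c)\<^sup>2) * A"
  proof -
    have "r\<^sup>2 \<le> p * (c - p)" using pr by (simp add: power2_eq_square algebra_simps)
    then have "r\<^sup>2 * (h - c)\<^sup>2 \<le> (p * (c - p)) * (h - c)\<^sup>2"
      by (rule mult_right_mono) simp
    also have "\<dots> \<le> (c * (c - p)) * ((2 * h - c - p) * (2 * h - c))"
    proof (intro mult_mono)
      have "h - c \<le> 2 * h - c - p" "h - c \<le> 2 * h - c" using c pc by auto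
      then show "(h - c)\<^sup>2 \<le> (2 * h - c - p) * (2 * h - c)"
        unfolding power2_eq_square using c by (intro mult_mono) auto
    qed (use c p pc in auto)
    also have "\<dots> = ((h - p)\<^sup>2 - (h - c)\<^sup>2) * A"
      by (simp add: A power2_eq_square algebra_simps)
    finally show ?thesis .
  qed
  have "0 \<le> (A * \<kappa> + h\<^sup>2 * r)\<^sup>2 + h\<^sup>2 * (((h - p)\<^sup>2 - (h - c)\<^sup>2) * A - r\<^sup>2 * (h - c)\<^sup>2)"
    using key by simp
  also have "\<dots> = A * (h\<^sup>2 * ((h - p)\<^sup>2 + (\<kappa> + r)\<^sup>2) - (h - c)\<^sup>2 * (h\<^sup>2 + \<kappa>\<^sup>2))"
    by (simp add: A_def power2_eq_square algebra_simps)
  finally show ?thesis using A0 by (simp add: zero_le_mult_iff)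
qed

text \<open>\<open>y0\<close> is the orthogonal projection of \<open>G n\<close> onto the span of
  the earlier vectors, and \<open>y\<close> is its counterpart for the shifted system. Their inner
  products with \<open>G n\<close> determine the two Schur complements, which reduces the claim to
  \<open>bordered_scalar_bound\<close>.\<close>

lemma bordered_gram_bound:
  assumes indep: "independent_upto m (Suc n) G"
    and u: "\<And>i. i < n \<Longrightarrow> (\<Sum>j<n. shifted_gram m G \<kappa> i j * u j) = cinner m (G i) (G n)"
    and u0: "\<And>i. i < n \<Longrightarrow> (\<Sum>j<n. cinner m (G i) (G j) * u0 j) = cinner m (G i) (G n)"
  shows "cmod (cinner m (G n) (G n) - (\<Sum>j<n. cinner m (G n) (G j) * u0 j)) * cmod (shifted_gram m G \<kappa> n n)
    \<le> cnorm2 m (G n) * cmod (shifted_gram m G \<kappa> n n - (\<Sum>j<n. cinner m (G n) (G j) * u j))"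
proof -
  define y y0 where "y = (\<lambda>k. \<Sum>j<n. u j * G j k)" and "y0 = (\<lambda>k. \<Sum>j<n. u0 j * G j k)"
  define h p c r where "h = cnorm2 m (G n)" and "p = cnorm2 m y" and "c = cnorm2 m y0"
    and "r = (\<Sum>i<n. \<kappa> i * (cmod (u i))\<^sup>2)"
  have gy: "(\<Sum>j<n. cinner m (G n) (G j) * u j) = cinner m (G n) y"
    and gy0: "(\<Sum>j<n. cinner m (G n) (G j) * u0 j) = cinner m (G n) y0"
    unfolding y_def y0_def cinner_sum_right by (simp_all add: mult.commute)
  have y0_orth: "cinner m (G i) y0 = cinner m (G i) (G n)" if "i < n" for i
    using u0[OF that] unfolding y0_def cinner_sum_right by (simp add: mult.commute)
  have "cinner m y (G n) = of_real p + \<i> * of_real r"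
    unfolding y_def p_def r_def
  proof (rule shifted_gram_quadratic)
    fix i assume i: "i < n"
    show "cinner m (G i) (\<lambda>k. \<Sum>j<n. u j * G j k) + \<i> * of_real (\<kappa> i) * u i = cinner m (G i) (G n)"
      using u[OF i] unfolding shifted_gram_row[OF i] .
  qed
  then have gy': "cinner m (G n) y = of_real p - \<i> * of_real r"
    using cinner_commute[of m y "G n"] by simp
  have y0n: "cinner m y0 (G n) = of_real c"
  proof -
    have "cinner m y0 (G n) = (\<Sum>j<n. cnj (u0 j) * cinner m (G j) y0)"
      unfolding y0_def cinner_sum_left by (simp add: y0_orth[unfolded y0_def])
    also have "\<dots> = cinner m y0 y0" by (subst (2) y0_def) (rule cinner_sum_left[symmetric])
    finally show ?thesis by (simp add: cinner_self c_def)
  qed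
  then have gy0': "cinner m (G n) y0 = of_real c" by (metis cinner_commute complex_cnj_complex_of_real)
  \<comment> \<open>\<open>y\<close> lies in the span of the earlier vectors, where
    \<open>y0\<close> and \<open>G n\<close> have the same inner products. Cauchy-Schwarz with
    \<open>y0\<close> then bounds by c p; with \<open>G n\<close> it would give only h p.\<close>
  have "cinner m y0 y = cinner m (G n) y"
  proof -
    have "cinner m y0 y = (\<Sum>j<n. u j * cnj (cinner m (G j) y0))"
      unfolding y_def cinner_sum_right cinner_commute ..
    also have "\<dots> = (\<Sum>j<n. u j * cnj (cinner m (G j) (G n)))" by (simp add: y0_orth)
    also have "\<dots> = cinner m (G n) y" unfolding y_def cinner_sum_right cinner_commute ..
    finally show ?thesis .
  qed
  then have "(cmod (of_real p - \<i> * of_real r))\<^sup>2 \<le> c * p"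
    using cinner_Cauchy_Schwarz[of m y0 y] by (simp add: gy' c_def p_def)
  then have pr: "p\<^sup>2 + r\<^sup>2 \<le> c * p" by (simp add: cmod_power2)
  have "h - c = cnorm2 m (\<lambda>k. G n k - y0 k)"
  proof -
    have "of_real (cnorm2 m (\<lambda>k. G n k - y0 k)) = cinner m (\<lambda>k. G n k - y0 k) (\<lambda>k. G n k - y0 k)"
      by (rule cinner_self[symmetric])
    also have "\<dots> = cinner m (G n) (G n) - cinner m (G n) y0 - cinner m y0 (G n) + cinner m y0 y0"
      by (simp add: cinner_def sum_subtractf[symmetric] sum.distrib[symmetric] algebra_simps)
    also have "\<dots> = of_real (h - c)" by (simp add: gy0' y0n cinner_self h_def c_def)
    finally show ?thesis by (metis of_real_eq_iff)
  qed
  \<comment> \<open>Independence makes c < h strict: otherwise \<open>G n\<close> would equal its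
    projection, a relation with coefficient -1 at index n.\<close>
  moreover have "cnorm2 m (\<lambda>k. G n k - y0 k) \<noteq> 0"
  proof
    assume "cnorm2 m (\<lambda>k. G n k - y0 k) = 0"
    then have "\<forall>k<m. G n k - y0 k = 0" using cnorm2_eq_0[of m "\<lambda>k. G n k - y0 k"] by blast
    then have "(\<Sum>j<Suc n. (if j = n then - 1 else u0 j) * G j k) = 0" if "k < m" for k
      using that by (simp add: y0_def)
    from independent_uptoD[of m "Suc n" G "\<lambda>j. if j = n then - 1 else u0 j" n, OF indep this]
    show False by simp
  qed
  ultimately have hc: "c < h" using cnorm2_nonneg[of m "\<lambda>k. G n k - y0 k"] by simp
  have "((h - c) * cmod (Complex h (\<kappa> n)))\<^sup>2 \<le> (h * cmod (Complex (h - p) (\<kappa> n + r)))\<^sup>2"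
    using bordered_scalar_bound[OF cnorm2_nonneg[of m y0, folded c_def] hc cnorm2_nonneg[of m y, folded p_def] pr, of "\<kappa> n"]
    by (simp add: power_mult_distrib cmod_power2)
  then have "(h - c) * cmod (Complex h (\<kappa> n)) \<le> h * cmod (Complex (h - p) (\<kappa> n + r))"
    by (rule power2_le_imp_le) (simp add: h_def cnorm2_nonneg)
  moreover have "shifted_gram m G \<kappa> n n = Complex h (\<kappa> n)"
    by (simp add: cinner_self h_def complex_eq_iff)
  moreover have "shifted_gram m G \<kappa> n n - cinner m (G n) y = Complex (h - p) (\<kappa> n + r)"
    by (simp add: cinner_self h_def gy' complex_eq_iff)
  moreover have "cmod (cinner m (G n) (G n) - cinner m (G n) y0) = h - c"
    using hc by (simp add: cinner_self gy0' h_def[symmetric] flip: of_real_diff)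
  ultimately show ?thesis unfolding gy gy0 h_def[symmetric] by simp
qed

text \<open>With \<open>H\<close> the Gram matrix and \<open>J = diag \<kappa>\<close>: the ratio \<open>|det (H + iJ)| / det H\<close>
  does not increase when \<open>H\<close> is replaced by its diagonal.\<close>

lemma gram_det_pinching:
  assumes "independent_upto m n G"
  shows "cmod (det (mat n n (\<lambda>(i, j). cinner m (G i) (G j)))) * (\<Prod>l<n. cmod (shifted_gram m G \<kappa> l l))
    \<le> cmod (det (mat n n (\<lambda>(i, j). shifted_gram m G \<kappa> i j))) * (\<Prod>l<n. cnorm2 m (G l))"
  using assms
proof (induction n)
  case 0
  then show ?case by simp
next
  case (Suc n)
  note indep = independent_upto_Suc[OF Suc.prems]
  have "\<exists>u. \<forall>i<n. (\<Sum>j<n. shifted_gram m G \<kappa> i j * u j) = cinner m (G i) (G n)"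
    by (rule linear_system_solvable(2)) (rule shifted_gram_kernel[OF indep])
  then obtain u where u: "\<forall>i<n. (\<Sum>j<n. shifted_gram m G \<kappa> i j * u j) = cinner m (G i) (G n)" ..
  \<comment> \<open>The plain Gram matrix is the shift by zero, so its system is solvable by the
    same kernel argument.\<close>
  have gram0: "cinner m (G i) (G j) + (if i = j then \<i> * of_real 0 else 0) = cinner m (G i) (G j)" for i j
    by simp
  have "\<exists>u. \<forall>i<n. (\<Sum>j<n. shifted_gram m G (\<lambda>_. 0) i j * u j) = cinner m (G i) (G n)"
    by (rule linear_system_solvable(2)) (rule shifted_gram_kernel[OF indep])
  then obtain u0 where u0: "\<forall>i<n. (\<Sum>j<n. cinner m (G i) (G j) * u0 j) = cinner m (G i) (G n)"
    unfolding gram0 ..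
  let ?K = "\<lambda>n. det (mat n n (\<lambda>(i, j). shifted_gram m G \<kappa> i j))"
  let ?H = "\<lambda>n. det (mat n n (\<lambda>(i, j). cinner m (G i) (G j)))"
  let ?a = "shifted_gram m G \<kappa> n n - (\<Sum>j<n. cinner m (G n) (G j) * u j)"
  let ?b = "cinner m (G n) (G n) - (\<Sum>j<n. cinner m (G n) (G j) * u0 j)"
  have "?K (Suc n) = (shifted_gram m G \<kappa> n n - (\<Sum>j<n. shifted_gram m G \<kappa> n j * u j)) * ?K n"
    by (rule det_bordered[of n "shifted_gram m G \<kappa>"]) (use u in auto)
  also have "(\<Sum>j<n. shifted_gram m G \<kappa> n j * u j) = (\<Sum>j<n. cinner m (G n) (G j) * u j)"
    by (intro sum.cong) auto
  finally have K: "?K (Suc n) = ?a * ?K n" .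
  have H: "?H (Suc n) = ?b * ?H n"
    by (rule det_bordered[of n "\<lambda>i j. cinner m (G i) (G j)"]) (use u0 in auto)
  have "cmod (?H (Suc n)) * (\<Prod>l<Suc n. cmod (shifted_gram m G \<kappa> l l))
      = (cmod ?b * cmod (shifted_gram m G \<kappa> n n)) * (cmod (?H n) * (\<Prod>l<n. cmod (shifted_gram m G \<kappa> l l)))"
    unfolding H by (simp add: norm_mult)
  also have "\<dots> \<le> (cnorm2 m (G n) * cmod ?a) * (cmod (?K n) * (\<Prod>l<n. cnorm2 m (G l)))"
  proof (rule mult_mono[OF bordered_gram_bound[OF Suc.prems] Suc.IH[OF indep]])
    show "(\<Sum>j<n. shifted_gram m G \<kappa> i j * u j) = cinner m (G i) (G n)" if "i < n" for i
      using u that by blast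
    show "(\<Sum>j<n. cinner m (G i) (G j) * u0 j) = cinner m (G i) (G n)" if "i < n" for i
      using u0 that by blast
  qed (intro mult_nonneg_nonneg prod_nonneg ballI cnorm2_nonneg norm_ge_zero)+
  also have "\<dots> = cmod (?K (Suc n)) * (\<Prod>l<Suc n. cnorm2 m (G l))"
    unfolding K by (simp add: norm_mult)
  finally show ?case .
qed

section \<open>Coupled block matrices as shifted Gram matrices\<close>

lemma prod_lessThan_add:
  fixes f :: "nat \<Rightarrow> 'a::comm_monoid_mult"
  shows "(\<Prod>l<n + m. f l) = (\<Prod>l<n. f l) * (\<Prod>l<m. f (n + l))"
  by (induction m) (auto simp: algebra_simps)

lemma sum_lessThan_add:
  fixes f :: "nat \<Rightarrow> 'a::comm_monoid_add"
  shows "(\<Sum>l<n + m. f l) = (\<Sum>l<n. f l) + (\<Sum>l<m. f (n + l))"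
  by (induction m) (auto simp: algebra_simps)

text \<open>The columns of \<open>mixing n s\<close> are, up to scale, the eigenvectors of a coupling
  \<open>[[0, B], [- B, 0]]\<close> with \<open>B\<close> diagonal. The free scale \<open>s\<close> does not affect the coupling and
  is used to balance the two diagonal blocks.\<close>

definition mixing :: "nat \<Rightarrow> (nat \<Rightarrow> real) \<Rightarrow> complex mat" where
  "mixing n s = four_block_mat (mat_diag n (\<lambda>j. of_real (1 / s j))) (mat_diag n (\<lambda>j. of_real (1 / s j)))
     (mat_diag n (\<lambda>j. \<i> * of_real (s j))) (mat_diag n (\<lambda>j. - (\<i> * of_real (s j))))"

lemma mixing_carrier [simp]: "mixing n s \<in> carrier_mat (n + n) (n + n)"
  by (simp add: mixing_def)

lemma mat_diag_index: "i < n \<Longrightarrow> j < n \<Longrightarrow> mat_diag n f $$ (i, j) = (if i = j then f j else 0)"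
  by (simp add: mat_diag_def)

lemma mat_diag_dims [simp]: "dim_row (mat_diag n f) = n" "dim_col (mat_diag n f) = n"
  by (simp_all add: mat_diag_def)

lemma mat_diag_mult_index:
  fixes M :: "complex mat"
  shows "dim_row M = n \<Longrightarrow> i < n \<Longrightarrow> j < dim_col M \<Longrightarrow> (mat_diag n f * M) $$ (i, j) = f i * M $$ (i, j)"
  by (subst mat_diag_mult_left[of _ _ "dim_col M"]) auto

lemma mult_mat_diag_index:
  fixes M :: "complex mat"
  shows "dim_col M = n \<Longrightarrow> i < dim_row M \<Longrightarrow> j < n \<Longrightarrow> (M * mat_diag n f) $$ (i, j) = M $$ (i, j) * f j"
  by (subst mat_diag_mult_right[of _ "dim_row M"]) auto

lemma mat_diag_zero: "mat_diag n (\<lambda>j. 0) = 0\<^sub>m n n"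
  by (rule eq_matI) (auto simp: mat_diag_index)

text \<open>Columns j and n + j of \<open>mixing\<close> belong to the same coordinate and differ in
  the sign of the imaginary unit. \<open>fold_index\<close> recovers the coordinate,
  \<open>half_sign\<close> the sign.\<close>

definition fold_index :: "nat \<Rightarrow> nat \<Rightarrow> nat" where
  "fold_index n l = (if l < n then l else l - n)"

definition half_sign :: "nat \<Rightarrow> nat \<Rightarrow> real" where
  "half_sign n l = (if l < n then 1 else -1)"

text \<open>In every coupling entry one factor 1 / s meets one factor s, so the scale cancels there.
  The contributions between columns j and n + j cancel too, and the skew coupling is left as the
  diagonal with entries 2 i b and - 2 i b.\<close>

lemma mixing_conjugation:
  assumes Z: "Z \<in> carrier_mat n n" and X: "X \<in> carrier_mat n n" and s: "\<And>j. j < n \<Longrightarrow> 0 < s j"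
  shows "mat_adjoint (mixing n s) *
      four_block_mat Z (mat_diag n (\<lambda>j. of_real (b j))) (mat_diag n (\<lambda>j. - of_real (b j))) X * mixing n s
    = mat (n + n) (n + n) (\<lambda>(i, j). let i' = fold_index n i; j' = fold_index n j in
        of_real (1 / s i' * (1 / s j')) * Z $$ (i', j')
        + of_real (half_sign n i * half_sign n j * (s i' * s j')) * X $$ (i', j')
        + (if i = j then \<i> * of_real (2 * b i' * half_sign n i) else 0))"
proof -
  let ?P = "mat_diag n (\<lambda>j. of_real (1 / s j)) :: complex mat"
  let ?Q = "mat_diag n (\<lambda>j. \<i> * of_real (s j)) :: complex mat"
  let ?Q' = "mat_diag n (\<lambda>j. - (\<i> * of_real (s j))) :: complex mat"
  let ?B = "mat_diag n (\<lambda>j. of_real (b j)) :: complex mat"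
  let ?B' = "mat_diag n (\<lambda>j. - of_real (b j)) :: complex mat"
  note md = mat_diag_dim[of n]
  have adj: "mat_adjoint (mixing n s) = four_block_mat ?P ?Q' ?P ?Q"
    unfolding mixing_def by (subst adj_four_block[OF md md md md]) (simp add: adj_diag)
  have s0: "s j \<noteq> 0" if "j < n" for j using s[OF that] by simp
  have c1: "?P * Z + ?Q' * ?B' \<in> carrier_mat n n" "?P * ?B + ?Q' * X \<in> carrier_mat n n"
    "?P * Z + ?Q * ?B' \<in> carrier_mat n n" "?P * ?B + ?Q * X \<in> carrier_mat n n"
    using Z X by auto
  show ?thesis (is "_ = ?rhs")
    unfolding adj mult_four_block_mat[OF md md md md Z md md X]
    unfolding mixing_def mult_four_block_mat[OF c1 md md md md]
  proof (rule eq_matI)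
    fix i j assume "i < dim_row ?rhs" "j < dim_col ?rhs"
    then have ij: "i < n + n" "j < n + n" by auto
    have dims: "dim_row Z = n" "dim_col Z = n" "dim_row X = n" "dim_col X = n" using Z X by auto
    note entry = mat_diag_mult_index mult_mat_diag_index mat_diag_index dims
    consider "i < n" "j < n" | "i < n" "\<not> j < n" "j - n < n" | "\<not> i < n" "i - n < n" "j < n"
      | "\<not> i < n" "i - n < n" "\<not> j < n" "j - n < n" using ij by linarith
    then show "four_block_mat ((?P * Z + ?Q' * ?B') * ?P + (?P * ?B + ?Q' * X) * ?Q)
        ((?P * Z + ?Q' * ?B') * ?P + (?P * ?B + ?Q' * X) * ?Q')
        ((?P * Z + ?Q * ?B') * ?P + (?P * ?B + ?Q * X) * ?Q)
        ((?P * Z + ?Q * ?B') * ?P + (?P * ?B + ?Q * X) * ?Q') $$ (i, j) = ?rhs $$ (i, j)"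
    proof cases
      case 1
      then show ?thesis using ij s0
        by (simp add: entry fold_index_def half_sign_def Let_def del: index_mult_mat(1) mat_diag_diag)
          (simp add: field_simps)
    next
      case 2
      then show ?thesis using ij s0
        by (simp add: entry fold_index_def half_sign_def Let_def del: index_mult_mat(1) mat_diag_diag)
          (simp add: field_simps)
    next
      case 3
      then show ?thesis using ij s0
        by (simp add: entry fold_index_def half_sign_def Let_def del: index_mult_mat(1) mat_diag_diag)
          (simp add: field_simps)
    next
      case 4
      then have eq: "(i = j) = (i - n = j - n)" by auto
      from 4 show ?thesis using ij s0
        by (simp add: entry fold_index_def half_sign_def Let_def eq del: index_mult_mat(1) mat_diag_diag)
          (simp add: field_simps)
    qed
  qed (use Z X in auto)
qed

text \<open>\<open>Z\<close> and \<open>X\<close> are Gram matrices, so the conjugate of their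
  direct sum by \<open>mixing\<close> is one as well, and the coupling becomes its imaginary shift.
  Conjugation multiplies the shifted and unshifted determinants by the same factor, so the pinching
  inequality transfers.\<close>

lemma block_det_pinching:
  fixes A D :: "complex mat" and b :: "nat \<Rightarrow> real"
  assumes A: "A \<in> carrier_mat r n" and D: "D \<in> carrier_mat n c"
  defines "X \<equiv> 1\<^sub>m n + mat_adjoint A * A" and "Z \<equiv> 1\<^sub>m n + D * mat_adjoint D"
    and "x \<equiv> \<lambda>j. 1 + (\<Sum>k<r. (cmod (A $$ (k, j)))\<^sup>2)" and "z \<equiv> \<lambda>j. 1 + (\<Sum>k<c. (cmod (D $$ (j, k)))\<^sup>2)"
  shows "cmod (det Z) * cmod (det X) * (\<Prod>j<n. 1 + (b j)\<^sup>2 / (x j * z j))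
    \<le> cmod (det (four_block_mat Z (mat_diag n (\<lambda>j. of_real (b j))) (mat_diag n (\<lambda>j. - of_real (b j))) X))"
proof -
  have X: "X \<in> carrier_mat n n" and Z: "Z \<in> carrier_mat n n" using A D by (auto simp: X_def Z_def)
  have x: "0 < x j" and z: "0 < z j" for j
    by (auto simp: x_def z_def intro!: add_pos_nonneg sum_nonneg)
  \<comment> \<open>This scale solves \<open>z / s\<^sup>2 = x * s\<^sup>2\<close>, both being
    \<open>w\<close>. The Gram diagonal entry is then 2 w, the least value that any scale gives,
    which makes the factor 1 + b^2 / (x z) come out exactly.\<close>
  define w s where "w = (\<lambda>j. sqrt (x j * z j))" and "s = (\<lambda>j. sqrt (w j / x j))"
  have w: "0 < w j" and w2: "w j * w j = x j * z j" for j using x[of j] z[of j] by (auto simp: w_def)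
  have s: "0 < s j" and s2: "s j * s j = w j / x j" for j using x[of j] w[of j] by (auto simp: s_def)
  \<comment> \<open>Vectors with Gram matrix \<open>Z\<close>: a unit vector followed by a
    conjugated row of \<open>D\<close>. The conjugation compensates for that in the first argument
    of \<open>cinner\<close>. In \<open>xc\<close> a column of \<open>A\<close> takes the place of
    the row.\<close>
  define zc where "zc = (\<lambda>j k. if k < n then (if k = j then 1 else 0) else cnj (D $$ (j, k - n)))"
  define xc where "xc = (\<lambda>j k. if k < n then (if k = j then 1 else 0) else A $$ (k - n, j))"
  define m where "m = (n + c) + (n + r)"
  define G where "G = (\<lambda>l k. let j = fold_index n l in
    if k < n + c then of_real (1 / s j) * zc j k else of_real (half_sign n l * s j) * xc j (k - (n + c)))"
  define \<kappa> where "\<kappa> = (\<lambda>l. 2 * b (fold_index n l) * half_sign n l)"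
  have fold: "fold_index n l < n" if "l < n + n" for l using that by (auto simp: fold_index_def)
  have delta: "(\<Sum>k<n. cnj (if k = j then 1 else 0) * (if k = j' then 1 else 0)) = (1\<^sub>m n $$ (j, j') :: complex)"
    if "j < n" "j' < n" for j j'
  proof -
    have "(\<Sum>k<n. cnj (if k = j then 1 else 0) * (if k = j' then 1 else 0)) = (\<Sum>k<n. if k = j then (if j = j' then 1 else 0) else (0 :: complex))"
      by (intro sum.cong) auto
    then show ?thesis using that by simp
  qed
  have zz: "(\<Sum>k<n + c. cnj (zc j k) * zc j' k) = Z $$ (j, j')" if "j < n" "j' < n" for j j'
  proof -
    have "Z $$ (j, j') = 1\<^sub>m n $$ (j, j') + (D * mat_adjoint D) $$ (j, j')"
      using that D by (simp add: Z_def)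
    also have "(D * mat_adjoint D) $$ (j, j') = (\<Sum>k<c. D $$ (j, k) * cnj (D $$ (j', k)))"
      using that D by (subst mult_index[of _ n c _ n]) (auto simp: adj_index)
    finally show ?thesis
      unfolding sum_lessThan_add delta[OF that, symmetric] by (simp add: zc_def)
  qed
  have xx: "(\<Sum>k<n + r. cnj (xc j k) * xc j' k) = X $$ (j, j')" if "j < n" "j' < n" for j j'
  proof -
    have "X $$ (j, j') = 1\<^sub>m n $$ (j, j') + (mat_adjoint A * A) $$ (j, j')"
      using that A by (simp add: X_def)
    also have "(mat_adjoint A * A) $$ (j, j') = (\<Sum>k<r. cnj (A $$ (k, j)) * A $$ (k, j'))"
      using that A by (subst mult_index[of _ n r _ n]) (auto simp: adj_index)
    finally show ?thesis
      unfolding sum_lessThan_add delta[OF that, symmetric] by (simp add: xc_def)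
  qed
  have gram: "cinner m (G l) (G l') = of_real (1 / s (fold_index n l) * (1 / s (fold_index n l'))) * Z $$ (fold_index n l, fold_index n l')
      + of_real (half_sign n l * half_sign n l' * (s (fold_index n l) * s (fold_index n l'))) * X $$ (fold_index n l, fold_index n l')"
    if "l < n + n" "l' < n + n" for l l'
  proof -
    have "cinner m (G l) (G l') = (\<Sum>k<n + c. of_real (1 / s (fold_index n l) * (1 / s (fold_index n l'))) * (cnj (zc (fold_index n l) k) * zc (fold_index n l') k))
      + (\<Sum>k<n + r. of_real (half_sign n l * half_sign n l' * (s (fold_index n l) * s (fold_index n l'))) * (cnj (xc (fold_index n l) k) * xc (fold_index n l') k))"
      unfolding cinner_def m_def sum_lessThan_add[of _ "n + c" "n + r"]
      by (intro arg_cong2[of _ _ _ _ "(+)"] sum.cong refl) (simp_all add: G_def Let_def)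
    then show ?thesis
      unfolding sum_distrib_left[symmetric] by (simp only: zz xx fold that)
  qed
  define \<Omega> where "\<Omega> = mixing n s"
  have \<Omega>: "\<Omega> \<in> carrier_mat (n + n) (n + n)" by (simp add: \<Omega>_def)
  \<comment> \<open>Kept as a function of the couplings: at 0 the conjugate is the Gram matrix, at
    \<open>b\<close> the shifted one, and both carry the same factor from
    \<open>\<Omega>\<close>.\<close>
  define K where "K = (\<lambda>b. four_block_mat Z (mat_diag n (\<lambda>j. complex_of_real (b j))) (mat_diag n (\<lambda>j. - of_real (b j))) X)"
  have K: "K b \<in> carrier_mat (n + n) (n + n)" for b using Z X by (simp add: K_def)
  have conj: "mat_adjoint \<Omega> * K b' * \<Omega> = mat (n + n) (n + n) (\<lambda>(i, j). shifted_gram m G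
      (\<lambda>l. 2 * b' (fold_index n l) * half_sign n l) i j)" for b'
    unfolding \<Omega>_def K_def mixing_conjugation[OF Z X s]
    by (rule cong_mat) (auto simp: gram Let_def)
  have det_conj: "det (mat_adjoint \<Omega> * K b' * \<Omega>) = det (mat_adjoint \<Omega>) * det (K b') * det \<Omega>" for b'
    using \<Omega> K[of b'] by (simp add: det_mult[of _ "n + n"] mult_carrier_mat[of _ "n + n" "n + n"])
  let ?H = "mat (n + n) (n + n) (\<lambda>(i, j). cinner m (G i) (G j))"
  let ?S = "mat (n + n) (n + n) (\<lambda>(i, j). shifted_gram m G \<kappa> i j)"
  have H: "mat_adjoint \<Omega> * K (\<lambda>_. 0) * \<Omega> = ?H"
    unfolding conj by (rule cong_mat) auto
  have S: "mat_adjoint \<Omega> * K b * \<Omega> = ?S"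
    unfolding conj \<kappa>_def ..
  have detK0: "det (K (\<lambda>_. 0)) = det Z * det X"
    unfolding K_def using det_four_block_mat_lower_left_zero[OF Z zero_carrier_mat refl X]
    by (simp add: mat_diag_zero)
  \<comment> \<open>The unit vectors inside \<open>zc\<close> and \<open>xc\<close> read off the sum
    and the difference of the coefficients at j and n + j.\<close>
  have indep: "independent_upto m (n + n) G"
    unfolding independent_upto_def
  proof (intro allI impI)
    fix u l assume u: "\<forall>k<m. (\<Sum>j<n + n. u j * G j k) = 0" and l: "l < n + n"
    have pm: "u j + u (n + j) = 0 \<and> u j - u (n + j) = 0" if j: "j < n" for j
    proof
      have pick: "(\<Sum>i<n. g i * (if j = i then 1 else 0)) = (g j :: complex)" for g
        using j by (simp add: if_distrib cong: if_cong)
      have "(\<Sum>i<n + n. u i * G i j) = (\<Sum>i<n. (of_real (1 / s i) * (u i + u (n + i))) * (if j = i then 1 else 0))"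
        unfolding sum_lessThan_add sum.distrib[symmetric] using j
        by (intro sum.cong) (auto simp: G_def fold_index_def zc_def algebra_simps)
      then have "of_real (1 / s j) * (u j + u (n + j)) = 0" using u j unfolding pick by (simp add: m_def)
      then show "u j + u (n + j) = 0" using s[of j] by simp
      have "(\<Sum>i<n + n. u i * G i (n + c + j)) = (\<Sum>i<n. (of_real (s i) * (u i - u (n + i))) * (if j = i then 1 else 0))"
        unfolding sum_lessThan_add sum.distrib[symmetric] using j
        by (intro sum.cong) (auto simp: G_def fold_index_def half_sign_def xc_def algebra_simps)
      then have "of_real (s j) * (u j - u (n + j)) = 0" using u j unfolding pick by (simp add: m_def)
      then show "u j - u (n + j) = 0" using s[of j] by simp
    qed
    have both: "u j = 0 \<and> u (n + j) = 0" if "j < n" for j using pm[OF that] by auto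
    show "u l = 0"
    proof (cases "l < n")
      case True
      then show ?thesis using both by blast
    next
      case False
      then show ?thesis using both[of "l - n"] l by auto
    qed
  qed
  have "det ?H \<noteq> 0"
  proof (rule linear_system_solvable(1))
    fix u j assume zero: "\<And>i. i < n + n \<Longrightarrow> (\<Sum>j<n + n. cinner m (G i) (G j) * u j) = 0" and j: "j < n + n"
    show "u j = 0"
    proof (rule shifted_gram_kernel[OF indep _ j, of "\<lambda>_. 0"])
      fix i assume i: "i < n + n"
      have "(\<Sum>j<n + n. shifted_gram m G (\<lambda>_. 0) i j * u j) = (\<Sum>j<n + n. cinner m (G i) (G j) * u j)"
        by (intro sum.cong) auto
      then show "(\<Sum>j<n + n. shifted_gram m G (\<lambda>_. 0) i j * u j) = 0" using zero[OF i] by simp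
    qed
  qed
  \<comment> \<open>Invertibility of \<open>\<Omega>\<close> is inferred from that of
    \<open>?H\<close> instead of evaluating its determinant.\<close>
  then have nz: "0 < cmod (det (mat_adjoint \<Omega>) * det \<Omega>)"
    unfolding H[symmetric] det_conj by auto
  have diagZ: "Z $$ (j, j) = of_real (z j)" and diagX: "X $$ (j, j) = of_real (x j)" if j: "j < n" for j
  proof -
    have "Z $$ (j, j) = of_real (cnorm2 (n + c) (zc j))"
      using zz[OF j j] by (simp add: cinner_self[symmetric] cinner_def)
    also have "cnorm2 (n + c) (zc j) = z j"
    proof -
      have "(\<Sum>k<n. (cmod (zc j k))\<^sup>2) = (\<Sum>k<n. if k = j then 1 else 0)"
        by (intro sum.cong) (auto simp: zc_def)
      then show ?thesis using j by (simp add: cnorm2_def sum_lessThan_add z_def) (simp add: zc_def)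
    qed
    finally show "Z $$ (j, j) = of_real (z j)" .
    have "X $$ (j, j) = of_real (cnorm2 (n + r) (xc j))"
      using xx[OF j j] by (simp add: cinner_self[symmetric] cinner_def)
    also have "cnorm2 (n + r) (xc j) = x j"
    proof -
      have "(\<Sum>k<n. (cmod (xc j k))\<^sup>2) = (\<Sum>k<n. if k = j then 1 else 0)"
        by (intro sum.cong) (auto simp: xc_def)
      then show ?thesis using j by (simp add: cnorm2_def sum_lessThan_add x_def) (simp add: xc_def)
    qed
    finally show "X $$ (j, j) = of_real (x j)" .
  qed
  have gram_diag: "cinner m (G l) (G l) = of_real (2 * w (fold_index n l))" if l: "l < n + n" for l
  proof -
    let ?j = "fold_index n l"
    have "half_sign n l * half_sign n l = 1" by (simp add: half_sign_def)
    then have "cinner m (G l) (G l) = of_real (1 / (s ?j * s ?j) * z ?j + s ?j * s ?j * x ?j)"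
      unfolding gram[OF l l] diagZ[OF fold[OF l]] diagX[OF fold[OF l]] by simp
    also have "1 / (s ?j * s ?j) * z ?j + s ?j * s ?j * x ?j = 2 * w ?j"
      unfolding s2 using x[of ?j] w[of ?j] w2[of ?j] by (simp add: field_simps)
    finally show ?thesis .
  qed
  have norm_diag: "cnorm2 m (G l) = 2 * w (fold_index n l)" if l: "l < n + n" for l
    using gram_diag[OF l] unfolding cinner_self by (metis of_real_eq_iff)
  have shift_diag: "cmod (shifted_gram m G \<kappa> l l) = 2 * sqrt ((w (fold_index n l))\<^sup>2 + (b (fold_index n l))\<^sup>2)"
    if l: "l < n + n" for l
  proof -
    let ?j = "fold_index n l"
    have "shifted_gram m G \<kappa> l l = Complex (2 * w ?j) (2 * b ?j * half_sign n l)"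
      unfolding gram_diag[OF l] \<kappa>_def by (simp add: complex_eq_iff)
    moreover have "(2 * b ?j * half_sign n l)\<^sup>2 = 4 * (b ?j)\<^sup>2"
      by (simp add: half_sign_def power_mult_distrib)
    ultimately have "cmod (shifted_gram m G \<kappa> l l) = sqrt (4 * ((w ?j)\<^sup>2 + (b ?j)\<^sup>2))"
      by (simp add: cmod_def power_mult_distrib)
    then show ?thesis by (simp only: real_sqrt_mult real_sqrt_four)
  qed
  define W where "W = (\<Prod>j<n. 4 * (w j)\<^sup>2)"
  have W: "0 < W" unfolding W_def using w by (intro prod_pos) (simp add: less_imp_neq[symmetric])
  have prod_norm: "(\<Prod>l<n + n. cnorm2 m (G l)) = W"
  proof -
    have "(\<Prod>l<n + n. cnorm2 m (G l)) = (\<Prod>l<n + n. 2 * w (fold_index n l))"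
      by (intro prod.cong) (auto simp: norm_diag)
    also have "\<dots> = W"
      unfolding prod_lessThan_add W_def prod.distrib[symmetric]
      by (intro prod.cong) (auto simp: fold_index_def power2_eq_square)
    finally show ?thesis .
  qed
  \<comment> \<open>Indices j and n + j have equal moduli, so the square roots pair off into
    squares.\<close>
  have prod_shift: "(\<Prod>l<n + n. cmod (shifted_gram m G \<kappa> l l)) = W * (\<Prod>j<n. 1 + (b j)\<^sup>2 / (x j * z j))"
  proof -
    have "(\<Prod>l<n + n. cmod (shifted_gram m G \<kappa> l l))
        = (\<Prod>l<n + n. 2 * sqrt ((w (fold_index n l))\<^sup>2 + (b (fold_index n l))\<^sup>2))"
      by (intro prod.cong refl shift_diag) simp
    also have "\<dots> = (\<Prod>j<n. 4 * ((w j)\<^sup>2 + (b j)\<^sup>2))"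
      unfolding prod_lessThan_add prod.distrib[symmetric]
      by (intro prod.cong) (auto simp: fold_index_def)
    also have "\<dots> = W * (\<Prod>j<n. 1 + (b j)\<^sup>2 / (x j * z j))"
      unfolding W_def prod.distrib[symmetric]
    proof (intro prod.cong refl)
      fix j
      show "4 * ((w j)\<^sup>2 + (b j)\<^sup>2) = 4 * (w j)\<^sup>2 * (1 + (b j)\<^sup>2 / (x j * z j))"
        unfolding power2_eq_square w2 using x[of j] z[of j] by (simp add: field_simps)
    qed
    finally show ?thesis .
  qed
  have "cmod (det ?H) * (W * (\<Prod>j<n. 1 + (b j)\<^sup>2 / (x j * z j))) \<le> cmod (det ?S) * W"
    using gram_det_pinching[OF indep, of \<kappa>] unfolding prod_norm prod_shift .
  then have "(cmod (det (mat_adjoint \<Omega>) * det \<Omega>) * W) * (cmod (det Z) * cmod (det X) * (\<Prod>j<n. 1 + (b j)\<^sup>2 / (x j * z j)))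
      \<le> (cmod (det (mat_adjoint \<Omega>) * det \<Omega>) * W) * cmod (det (K b))"
    unfolding H[symmetric] S[symmetric] det_conj detK0 by (simp add: norm_mult mult_ac)
  then show ?thesis
    using nz W unfolding K_def by (simp add: mult_le_cancel_left_pos del: norm_mult)
qed

section \<open>Spectral decompositions\<close>

lemma unitary_first_column:
  fixes v :: "complex vec"
  assumes v: "v \<in> carrier_vec (Suc n)" "v \<noteq> 0\<^sub>v (Suc n)"
  shows "\<exists>U c. unitary_mat (Suc n) U \<and> (\<forall>i<Suc n. U $$ (i, 0) = c * v $ i)"
proof -
  let ?N = "Suc n"
  interpret cof_vec_space ?N "TYPE(complex)" .
  define bs where "bs = basis_completion v"
  define ws where "ws = gram_schmidt ?N bs"
  note bc = basis_completion[OF v, folded bs_def]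
  from bc have "bs \<noteq> []" by auto
  then obtain vs where bv: "bs = v # vs" using bc by (cases bs) auto
  have ws: "set ws \<subseteq> carrier_vec ?N" "corthogonal ws" "length ws = ?N"
    using gram_schmidt_result[of bs ws] bc by (auto simp: ws_def)
  have hd: "hd ws = v" using gram_schmidt_hd[OF v(1), of vs] bv by (simp add: ws_def)
  have wi: "ws ! i \<in> carrier_vec ?N" if "i < ?N" for i using ws that by auto
  define N where "N = (\<lambda>i. \<Sum>k<?N. (cmod (ws ! i $ k))\<^sup>2)"
  have dot: "ws ! j \<bullet>c ws ! i = (\<Sum>k<?N. cnj (ws ! i $ k) * ws ! j $ k)" if "i < ?N" "j < ?N" for i j
    using wi[OF that(1)] wi[OF that(2)] by (auto simp: scalar_prod_def lessThan_atLeast0 mult.commute intro!: sum.cong)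
  have dotN: "ws ! i \<bullet>c ws ! i = of_real (N i)" if "i < ?N" for i
    unfolding dot[OF that that] N_def by (simp add: mult.commute flip: complex_norm_square)
  have N: "0 < N i" if "i < ?N" for i
  proof -
    have "N i \<noteq> 0" using corthogonalD[OF ws(2), of i i] that ws(3) dotN[OF that] by auto
    moreover have "0 \<le> N i" by (simp add: N_def sum_nonneg)
    ultimately show ?thesis by simp
  qed
  define U where "U = mat ?N ?N (\<lambda>(i, j). of_real (1 / sqrt (N j)) * ws ! j $ i)"
  have U: "U \<in> carrier_mat ?N ?N" by (simp add: U_def)
  have "mat_adjoint U * U = 1\<^sub>m ?N"
  proof (rule eq_matI)
    fix i j assume "i < dim_row (1\<^sub>m ?N)" "j < dim_col (1\<^sub>m ?N)"
    then have ij: "i < ?N" "j < ?N" by auto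
    have "(mat_adjoint U * U) $$ (i, j) = (\<Sum>k<?N. cnj (U $$ (k, i)) * U $$ (k, j))"
      using U ij by (subst mult_index[of _ ?N ?N _ ?N]) (auto simp: adj_index)
    also have "\<dots> = of_real (1 / sqrt (N i) * (1 / sqrt (N j))) * (ws ! j \<bullet>c ws ! i)"
      unfolding dot[OF ij] sum_distrib_left using ij by (intro sum.cong) (auto simp: U_def)
    also have "\<dots> = 1\<^sub>m ?N $$ (i, j)"
    proof (cases "i = j")
      case True
      have "1 / sqrt (N j) * (1 / sqrt (N j)) * N j = 1" using N[OF ij(2)] by simp
      then have "of_real (1 / sqrt (N j) * (1 / sqrt (N j))) * of_real (N j) = (1 :: complex)"
        by (metis of_real_1 of_real_mult)
      then show ?thesis using True ij dotN[OF ij(2)] by simp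
    next
      case False
      then show ?thesis using corthogonalD[OF ws(2), of j i] ij ws(3) by auto
    qed
    finally show "(mat_adjoint U * U) $$ (i, j) = 1\<^sub>m ?N $$ (i, j)" .
  qed (use U in auto)
  moreover have "U $$ (i, 0) = of_real (1 / sqrt (N 0)) * v $ i" if "i < ?N" for i
    using that hd ws(3) hd_conv_nth[of ws] by (force simp: U_def)
  ultimately show ?thesis using U unfolding unitary_mat_def by blast
qed

lemma unitaryD:
  assumes "unitary_mat n U"
  shows "U \<in> carrier_mat n n" "mat_adjoint U \<in> carrier_mat n n" "mat_adjoint U * U = 1\<^sub>m n" "U * mat_adjoint U = 1\<^sub>m n"
  using assms mat_mult_left_right_inverse[of "mat_adjoint U" n U] by (auto simp: unitary_mat_def)

lemma unitary_mult:
  assumes U: "unitary_mat n U" and V: "unitary_mat n V"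
  shows "unitary_mat n (U * V)"
proof -
  note u = unitaryD[OF U] and v = unitaryD[OF V]
  have "mat_adjoint (U * V) * (U * V) = mat_adjoint V * (mat_adjoint U * U) * V"
    unfolding adj_mult[OF u(1) v(1)] using u(1,2) v(1,2)
    by (simp add: mult_carrier_mat[of _ n n _ n] assoc_mult_mat[of _ n n _ n _ n])
  then show ?thesis using u v by (simp add: unitary_mat_def)
qed

lemma mult_conjugation:
  fixes U V E V' U' :: "complex mat"
  assumes "U \<in> carrier_mat n n" "V \<in> carrier_mat n n" "E \<in> carrier_mat n n"
    "V' \<in> carrier_mat n n" "U' \<in> carrier_mat n n"
  shows "(U * V) * E * (V' * U') = U * (V * E * V') * U'"
  using assms by (simp add: mult_carrier_mat[of _ n n _ n] assoc_mult_mat[of _ n n _ n _ n])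

text \<open>Deflation: in an orthonormal basis starting with an eigenvector, the first column is a
  multiple of a unit vector. Hermitian symmetry then clears the first row, makes the eigenvalue real
  and leaves a smaller Hermitian block.\<close>

lemma hermitian_spectral:
  fixes M :: "complex mat"
  assumes "M \<in> carrier_mat n n" "mat_adjoint M = M"
  shows "\<exists>U d. unitary_mat n U \<and> M = U * diag_of_reals n d * mat_adjoint U"
  using assms
proof (induction n arbitrary: M)
  case 0
  then show ?case
    by (intro exI[of _ "1\<^sub>m 0"] exI[of _ "\<lambda>_. 0"]) (auto simp: unitary_mat_def intro!: eq_matI)
next
  case (Suc n)
  let ?N = "Suc n"
  note M = Suc.prems(1)
  have "degree (char_poly M) = ?N" using degree_monic_char_poly[OF M] by simp
  then have "\<not> constant (poly (char_poly M))" by (simp add: constant_degree)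
  then obtain e where "poly (char_poly M) e = 0" using fundamental_theorem_of_algebra by blast
  then have "eigenvalue M e" using eigenvalue_root_char_poly[OF M] by simp
  then obtain v where v: "v \<in> carrier_vec ?N" "v \<noteq> 0\<^sub>v ?N" "M *\<^sub>v v = e \<cdot>\<^sub>v v"
    using M unfolding eigenvalue_def eigenvector_def by auto
  obtain U c where U: "unitary_mat ?N U" and U0: "\<forall>i<?N. U $$ (i, 0) = c * v $ i"
    using unitary_first_column[OF v(1,2)] by blast
  note u = unitaryD[OF U]
  define M' where "M' = mat_adjoint U * (M * U)"
  have MU: "M * U \<in> carrier_mat ?N ?N" using M u(1) by simp
  have M': "M' \<in> carrier_mat ?N ?N" using MU u(2) by (simp add: M'_def)
  have MU0: "(M * U) $$ (i, 0) = e * U $$ (i, 0)" if i: "i < ?N" for i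
  proof -
    have "(M * U) $$ (i, 0) = c * (\<Sum>k<?N. M $$ (i, k) * v $ k)"
      using i M u(1) U0 by (subst mult_index[of _ ?N ?N _ ?N]) (auto simp: sum_distrib_left mult_ac simp del: sum.lessThan_Suc intro!: sum.cong)
    also have "(\<Sum>k<?N. M $$ (i, k) * v $ k) = (M *\<^sub>v v) $ i"
      using i M v(1) by (auto simp: scalar_prod_def lessThan_atLeast0 intro!: sum.cong)
    also have "\<dots> = e * v $ i" using i v by simp
    finally show ?thesis using U0 i by simp
  qed
  have col0: "M' $$ (i, 0) = (if i = 0 then e else 0)" if i: "i < ?N" for i
  proof -
    have "M' $$ (i, 0) = (\<Sum>k<?N. mat_adjoint U $$ (i, k) * (e * U $$ (k, 0)))"
      unfolding M'_def using i MU0 by (subst mult_index[OF u(2) MU]) (auto intro!: sum.cong)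
    also have "\<dots> = e * (mat_adjoint U * U) $$ (i, 0)"
      using i by (subst mult_index[OF u(2,1)]) (auto simp: sum_distrib_left mult_ac simp del: sum.lessThan_Suc intro!: sum.cong)
    finally show ?thesis using i u(3) by simp
  qed
  have herm: "mat_adjoint M' = M'"
    unfolding M'_def adj_mult[OF u(2) MU] adj_mult[OF M u(1)] Suc.prems(2)
    using M u(1,2) by (simp add: assoc_mult_mat[of _ ?N ?N _ ?N _ ?N])
  have row0: "M' $$ (0, j) = (if j = 0 then cnj e else 0)" if j: "j < ?N" for j
    using arg_cong[OF herm, of "\<lambda>X. X $$ (0, j)"] col0[OF j] j M' by (auto simp: adj_index)
  have "e = cnj e" using col0[of 0] row0[of 0] by simp
  then have e: "e = of_real (Re e)" by (simp add: complex_eq_iff)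
  define M3 where "M3 = mat n n (\<lambda>(i, j). M' $$ (Suc i, Suc j))"
  have M3: "M3 \<in> carrier_mat n n" by (simp add: M3_def)
  have "mat_adjoint M3 = M3"
  proof (rule eq_matI)
    fix i j assume "i < dim_row M3" "j < dim_col M3"
    then have ij: "i < n" "j < n" using M3 by auto
    then show "mat_adjoint M3 $$ (i, j) = M3 $$ (i, j)"
      using arg_cong[OF herm, of "\<lambda>X. X $$ (Suc i, Suc j)"] M' by (simp add: adj_index M3_def)
  qed (use M3 in auto)
  from Suc.IH[OF M3 this] obtain V d where V: "unitary_mat n V" and M3V: "M3 = V * diag_of_reals n d * mat_adjoint V"
    by blast
  note vv = unitaryD[OF V]
  have block: "M' = four_block_mat (mat_diag 1 (\<lambda>_. e)) (0\<^sub>m 1 n) (0\<^sub>m n 1) M3"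
  proof (rule eq_matI)
    fix i j assume "i < dim_row (four_block_mat (mat_diag 1 (\<lambda>_. e)) (0\<^sub>m 1 n) (0\<^sub>m n 1) M3)"
      "j < dim_col (four_block_mat (mat_diag 1 (\<lambda>_. e)) (0\<^sub>m 1 n) (0\<^sub>m n 1) M3)"
    then have ij: "i < ?N" "j < ?N" using M3 by (auto simp: mat_diag_def)
    show "M' $$ (i, j) = four_block_mat (mat_diag 1 (\<lambda>_. e)) (0\<^sub>m 1 n) (0\<^sub>m n 1) M3 $$ (i, j)"
      using ij col0[of i] row0[of j] M3 by (cases i; cases j) (auto simp: mat_diag_def M3_def)
  qed (use M' M3 in \<open>auto simp: mat_diag_def\<close>)
  let ?V = "four_block_mat (1\<^sub>m 1) (0\<^sub>m 1 n) (0\<^sub>m n 1) V"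
  let ?d = "\<lambda>i. case i of 0 \<Rightarrow> Re e | Suc i \<Rightarrow> d i"
  have adjV: "mat_adjoint ?V = four_block_mat (1\<^sub>m 1) (0\<^sub>m 1 n) (0\<^sub>m n 1) (mat_adjoint V)"
    by (subst adj_four_block[OF one_carrier_mat zero_carrier_mat zero_carrier_mat vv(1)]) simp
  have diag: "diag_of_reals ?N ?d = four_block_mat (mat_diag 1 (\<lambda>_. e)) (0\<^sub>m 1 n) (0\<^sub>m n 1) (diag_of_reals n d)"
    using e by (intro eq_matI) (auto simp: diag_of_reals_def mat_diag_def split: nat.splits)
  have Vu: "unitary_mat ?N ?V"
  proof -
    have "mat_adjoint ?V * ?V = 1\<^sub>m ?N"
      unfolding adjV
        mult_four_block_mat[OF one_carrier_mat zero_carrier_mat zero_carrier_mat vv(2) one_carrier_mat zero_carrier_mat zero_carrier_mat vv(1)]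
      using vv by simp
    moreover have "?V \<in> carrier_mat ?N ?N" using vv(1) four_block_carrier_mat[OF one_carrier_mat[of 1] vv(1)] by simp
    ultimately show ?thesis by (simp add: unitary_mat_def)
  qed
  note vu = unitaryD[OF Vu]
  have "?V * diag_of_reals ?N ?d * mat_adjoint ?V = M'"
  proof -
    have Vd: "V * diag_of_reals n d \<in> carrier_mat n n" using vv(1) by simp
    have 1: "?V * diag_of_reals ?N ?d = four_block_mat (mat_diag 1 (\<lambda>_. e)) (0\<^sub>m 1 n) (0\<^sub>m n 1) (V * diag_of_reals n d)"
      unfolding diag mult_four_block_mat[OF one_carrier_mat zero_carrier_mat zero_carrier_mat vv(1) mat_diag_dim zero_carrier_mat zero_carrier_mat diag_of_reals_carrier]
      by (simp only: left_mult_one_mat[OF mat_diag_dim] left_mult_zero_mat[OF mat_diag_dim]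
          left_mult_zero_mat[OF diag_of_reals_carrier] left_mult_zero_mat[OF zero_carrier_mat]
          right_mult_zero_mat[OF one_carrier_mat] right_mult_zero_mat[OF vv(1)] right_add_zero_mat[OF mat_diag_dim]
          right_add_zero_mat[OF zero_carrier_mat] left_add_zero_mat[OF Vd])
    show ?thesis
      unfolding 1 adjV block mult_four_block_mat[OF mat_diag_dim zero_carrier_mat zero_carrier_mat Vd one_carrier_mat zero_carrier_mat zero_carrier_mat vv(2)]
      by (simp only: right_mult_one_mat[OF mat_diag_dim] left_mult_zero_mat[OF one_carrier_mat]
          left_mult_zero_mat[OF zero_carrier_mat] left_mult_zero_mat[OF vv(2)]
          right_mult_zero_mat[OF mat_diag_dim] right_mult_zero_mat[OF Vd] right_add_zero_mat[OF mat_diag_dim]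
          right_add_zero_mat[OF zero_carrier_mat] left_add_zero_mat[OF M3] flip: M3V)
  qed
  moreover have "M = U * M' * mat_adjoint U"
  proof -
    have "U * M' * mat_adjoint U = (U * mat_adjoint U) * M * (U * mat_adjoint U)"
      unfolding M'_def using M u(1,2) by (simp add: assoc_mult_mat[of _ ?N ?N _ ?N _ ?N] mult_carrier_mat[of _ ?N ?N _ ?N])
    then show ?thesis using u(4) M by simp
  qed
  moreover have "(U * ?V) * diag_of_reals ?N ?d * (mat_adjoint ?V * mat_adjoint U)
      = U * (?V * diag_of_reals ?N ?d * mat_adjoint ?V) * mat_adjoint U"
    by (rule mult_conjugation[OF u(1) vu(1) diag_of_reals_carrier vu(2) u(2)])
  ultimately have "M = (U * ?V) * diag_of_reals ?N ?d * mat_adjoint (U * ?V)"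
    unfolding adj_mult[OF u(1) vu(1)] by metis
  then show ?case using unitary_mult[OF U Vu] by blast
qed

lemma unitary_conj_diag_index:
  assumes U: "U \<in> carrier_mat n n" and ij: "i < n" "j < n"
  shows "(U * mat_diag n f * mat_adjoint U) $$ (i, j) = (\<Sum>l<n. U $$ (i, l) * f l * cnj (U $$ (j, l)))"
proof -
  have "U * mat_diag n f \<in> carrier_mat n n" using U by simp
  then show ?thesis
    using U ij by (subst mult_index[of _ n n _ n])
      (auto simp: adj_index mult_mat_diag_index simp del: index_mult_mat(1) intro!: sum.cong)
qed

lemma mat_trace_unitary_conj:
  assumes "unitary_mat n U"
  shows "mat_trace (U * mat_diag n f * mat_adjoint U) = (\<Sum>l<n. f l)"
proof -
  note u = unitaryD[OF assms]
  have "mat_trace (U * mat_diag n f * mat_adjoint U)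
      = (\<Sum>i<n. \<Sum>l<n. U $$ (i, l) * f l * cnj (U $$ (i, l)))"
    using u(1) by (simp add: mat_trace_def unitary_conj_diag_index[OF u(1)] del: index_mult_mat(1))
  also have "\<dots> = (\<Sum>l<n. f l * (\<Sum>i<n. cnj (U $$ (i, l)) * U $$ (i, l)))"
    unfolding sum_distrib_left by (subst sum.swap) (simp add: mult_ac)
  also have "\<dots> = (\<Sum>l<n. f l)"
  proof (intro sum.cong refl)
    fix l assume "l \<in> {..<n}"
    then have l: "l < n" by simp
    have "(\<Sum>i<n. cnj (U $$ (i, l)) * U $$ (i, l)) = (mat_adjoint U * U) $$ (l, l)"
      using u(1) l by (subst mult_index[OF u(2,1)]) (auto simp: adj_index)
    then show "f l * (\<Sum>i<n. cnj (U $$ (i, l)) * U $$ (i, l)) = f l" using u(3) l by simp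
  qed
  finally show ?thesis .
qed

lemma vn_entropy_spectral:
  assumes "unitary_mat n U"
  shows "vn_entropy (U * diag_of_reals n d * mat_adjoint U) = - (\<Sum>i<n. d i * log 2 (d i))"
  unfolding vn_entropy_def herm_fun_eq[OF assms]
  unfolding diag_of_reals_def mat_trace_unitary_conj[OF assms] by simp

lemma smult_unitary_conj:
  assumes "unitary_mat n U"
  shows "of_real c \<cdot>\<^sub>m (U * diag_of_reals n d * mat_adjoint U) = U * diag_of_reals n (\<lambda>i. c * d i) * mat_adjoint U"
  using unitaryD[OF assms]
  by (intro eq_matI) (auto simp: diag_of_reals_def unitary_conj_diag_index sum_distrib_left mult_ac
      simp del: index_mult_mat(1))

lemma det_unitary_conj:
  assumes "unitary_mat n U"
  shows "det (1\<^sub>m n + U * diag_of_reals n d * mat_adjoint U) = of_real (\<Prod>i<n. 1 + d i)"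
proof -
  note u = unitaryD[OF assms]
  have UD: "U * diag_of_reals n d \<in> carrier_mat n n" using u(1) by simp
  have "det (1\<^sub>m n + U * diag_of_reals n d * mat_adjoint U) = det (1\<^sub>m n + mat_adjoint U * (U * diag_of_reals n d))"
    by (rule det_one_plus_commute[OF UD u(2)])
  also have "mat_adjoint U * (U * diag_of_reals n d) = diag_of_reals n d"
    using u assoc_mult_mat[OF u(2,1) diag_of_reals_carrier] by (metis diag_of_reals_carrier left_mult_one_mat)
  also have "1\<^sub>m n + diag_of_reals n d = mat_diag n (\<lambda>i. of_real (1 + d i))"
    by (rule eq_matI) (auto simp: diag_of_reals_def mat_diag_index)
  also have "det \<dots> = prod_list (diag_mat (mat_diag n (\<lambda>i. complex_of_real (1 + d i))))"
    by (rule det_upper_triangular[of _ n]) (auto simp: upper_triangular_def mat_diag_index)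
  also have "diag_mat (mat_diag n (\<lambda>i. complex_of_real (1 + d i))) = map (\<lambda>i. of_real (1 + d i)) [0..<n]"
    by (auto simp: diag_mat_def mat_diag_index)
  also have "prod_list (map (\<lambda>i. complex_of_real (1 + d i)) [0..<n]) = (\<Prod>i<n. of_real (1 + d i))"
    using prod.distinct_set_conv_list[of "[0..<n]" "\<lambda>i. complex_of_real (1 + d i)"] by (simp add: lessThan_atLeast0)
  finally show ?thesis by simp
qed

section \<open>Frobenius norms and spectra of Gram matrices\<close>

definition frob2 :: "complex mat \<Rightarrow> real" where
  "frob2 M = (\<Sum>i<dim_row M. \<Sum>j<dim_col M. (cmod (M $$ (i, j)))\<^sup>2)"

lemma frob2_nonneg: "0 \<le> frob2 M"
  by (simp add: frob2_def sum_nonneg)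

lemma frob2_trace: "mat_trace (M * mat_adjoint M) = of_real (frob2 M)"
proof -
  have "mat_trace (M * mat_adjoint M) = (\<Sum>i<dim_row M. \<Sum>j<dim_col M. M $$ (i, j) * cnj (M $$ (i, j)))"
    unfolding mat_trace_def
    by (intro sum.cong) (auto simp: mult_index[of _ "dim_row M" "dim_col M" _ "dim_row M"] adj_index simp del: index_mult_mat(1))
  then show ?thesis by (simp add: frob2_def flip: complex_norm_square)
qed

lemma frob2_adjoint: "frob2 (mat_adjoint M) = frob2 M"
proof -
  have "frob2 (mat_adjoint M) = (\<Sum>i<dim_col M. \<Sum>j<dim_row M. (cmod (M $$ (j, i)))\<^sup>2)"
    unfolding frob2_def by (intro sum.cong) (auto simp: adj_index)
  then show ?thesis unfolding frob2_def by (simp add: sum.swap[of _ "{..<dim_col M}"])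
qed

lemma frob_norm_square: "(frob_norm M)\<^sup>2 = frob2 M"
  using frob2_trace[of "mat_adjoint M"] frob2_nonneg[of M] by (simp add: frob_norm_def frob2_adjoint)

text \<open>One choice of eigenvalues serves the trace, the entropies and the determinants at once.
  The factor \<open>c\<close> is for the normalized blocks, \<open>t\<close> for the logarithmic
  determinants.\<close>

lemma gram_eigenvalues:
  fixes M :: "complex mat"
  assumes M: "M \<in> carrier_mat n m"
  shows "\<exists>d. (\<forall>i<n. 0 \<le> d i) \<and> (\<Sum>i<n. d i) = frob2 M \<and>
    (\<forall>c. vn_entropy (of_real c \<cdot>\<^sub>m (M * mat_adjoint M)) = - (\<Sum>i<n. (c * d i) * log 2 (c * d i))) \<and>
    (\<forall>t. det (1\<^sub>m n + of_real t \<cdot>\<^sub>m (M * mat_adjoint M)) = of_real (\<Prod>i<n. 1 + t * d i))"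
proof -
  have MM: "M * mat_adjoint M \<in> carrier_mat n n" using M by simp
  have "mat_adjoint (M * mat_adjoint M) = M * mat_adjoint M"
    using adj_mult[OF M mat_adjoint_carrier[OF M]] by simp
  then obtain U d where U: "unitary_mat n U" and MU: "M * mat_adjoint M = U * diag_of_reals n d * mat_adjoint U"
    using hermitian_spectral[OF MM] by blast
  note u = unitaryD[OF U]
  show ?thesis
  proof (intro exI[of _ d] conjI allI impI)
    have "of_real (\<Sum>i<n. d i) = (of_real (frob2 M) :: complex)"
      using frob2_trace[of M] unfolding MU diag_of_reals_def mat_trace_unitary_conj[OF U] by simp
    then show "(\<Sum>i<n. d i) = frob2 M" by (metis of_real_eq_iff)
    show "vn_entropy (of_real c \<cdot>\<^sub>m (M * mat_adjoint M)) = - (\<Sum>i<n. (c * d i) * log 2 (c * d i))" for c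
      unfolding MU smult_unitary_conj[OF U] vn_entropy_spectral[OF U] ..
    show "det (1\<^sub>m n + of_real t \<cdot>\<^sub>m (M * mat_adjoint M)) = of_real (\<Prod>i<n. 1 + t * d i)" for t
      unfolding MU smult_unitary_conj[OF U] det_unitary_conj[OF U] ..
    show "0 \<le> d i" if i: "i < n" for i
    proof -
      \<comment> \<open>The eigenvalue \<open>d i\<close> is the squared norm of row i of this
        matrix.\<close>
      define W where "W = mat_adjoint U * M"
      have W: "W \<in> carrier_mat n m" using u(2) M by (simp add: W_def)
      have M'U: "mat_adjoint M * U \<in> carrier_mat m n" by (rule mult_carrier_mat[OF mat_adjoint_carrier[OF M] u(1)])
      have "W * mat_adjoint W = mat_adjoint U * (M * mat_adjoint M) * U"
        unfolding W_def adj_mult[OF u(2) M] adj_adj assoc_mult_mat[OF u(2) M M'U]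
          assoc_mult_mat[OF M mat_adjoint_carrier[OF M] u(1), symmetric] assoc_mult_mat[OF u(2) MM u(1)] ..
      also have "\<dots> = (mat_adjoint U * U) * diag_of_reals n d * (mat_adjoint U * U)"
        unfolding MU using u(1,2)
        by (simp add: mult_carrier_mat[of _ n n _ n] assoc_mult_mat[of _ n n _ n _ n])
      also have "\<dots> = diag_of_reals n d"
        unfolding u(3) by (metis diag_of_reals_carrier left_mult_one_mat right_mult_one_mat)
      finally have "of_real (d i) = (W * mat_adjoint W) $$ (i, i)"
        using i by (simp add: diag_of_reals_def mat_diag_index)
      also have "\<dots> = of_real (\<Sum>k<m. (cmod (W $$ (i, k)))\<^sup>2)"
        using i W by (subst mult_index[OF W mat_adjoint_carrier[OF W]]) (auto simp: adj_index simp flip: complex_norm_square)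
      finally have "d i = (\<Sum>k<m. (cmod (W $$ (i, k)))\<^sup>2)" by (metis of_real_eq_iff)
      then show ?thesis by (simp add: sum_nonneg)
    qed
  qed
qed

text \<open>A substitute for the singular value decomposition: letting \<open>U\<close> and \<open>V\<close> be coisometries on a
  larger space avoids completing orthonormal systems. The missing columns of \<open>U\<close> are those of the
  projection \<open>R\<close> onto the complement of the range of \<open>B\<close>.\<close>

lemma coisometric_diagonalization:
  fixes B :: "complex mat"
  assumes B: "B \<in> carrier_mat m n"
  obtains N U V b where "U \<in> carrier_mat m N" "V \<in> carrier_mat n N"
    "U * mat_adjoint U = 1\<^sub>m m" "V * mat_adjoint V = 1\<^sub>m n"
    "mat_adjoint U * (B * V) = mat_diag N (\<lambda>j. of_real (b j))"
proof -
  have BB: "mat_adjoint B * B \<in> carrier_mat n n" using mult_carrier_mat[OF mat_adjoint_carrier[OF B] B] .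
  have "mat_adjoint (mat_adjoint B * B) = mat_adjoint B * B"
    using adj_mult[OF mat_adjoint_carrier[OF B] B] by simp
  then obtain V d where V: "unitary_mat n V" and BV: "mat_adjoint B * B = V * diag_of_reals n d * mat_adjoint V"
    using hermitian_spectral[OF BB] by blast
  note v = unitaryD[OF V]
  define Y where "Y = B * V"
  have Y: "Y \<in> carrier_mat m n" using B v(1) by (simp add: Y_def)
  have aY: "mat_adjoint Y \<in> carrier_mat n m" using Y by simp
  have YY: "mat_adjoint Y * Y = diag_of_reals n d"
  proof -
    have "mat_adjoint Y * Y = mat_adjoint V * (mat_adjoint B * B) * V"
      unfolding Y_def adj_mult[OF B v(1)] using B v(1,2)
      by (simp add: assoc_mult_mat[of _ n m _ n _ n] assoc_mult_mat[of _ n n _ m _ n] assoc_mult_mat[of _ n n _ n _ n]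
          mult_carrier_mat[of _ n m _ n] mult_carrier_mat[of _ m n _ n])
    also have "\<dots> = (mat_adjoint V * V) * diag_of_reals n d * (mat_adjoint V * V)"
      unfolding BV using v(1,2)
      by (simp add: mult_carrier_mat[of _ n n _ n] assoc_mult_mat[of _ n n _ n _ n])
    also have "\<dots> = diag_of_reals n d"
      unfolding v(3) by (metis diag_of_reals_carrier left_mult_one_mat right_mult_one_mat)
    finally show ?thesis .
  qed
  have dj: "d j = (\<Sum>k<m. (cmod (Y $$ (k, j)))\<^sup>2)" if j: "j < n" for j
  proof -
    have "complex_of_real (d j) = (mat_adjoint Y * Y) $$ (j, j)"
      unfolding YY using j by (simp add: diag_of_reals_def mat_diag_index)
    also have "\<dots> = of_real (\<Sum>k<m. (cmod (Y $$ (k, j)))\<^sup>2)"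
      using Y j by (subst mult_index[OF aY Y]) (auto simp: adj_index mult.commute simp flip: complex_norm_square)
    finally show ?thesis by (metis of_real_eq_iff)
  qed
  have d: "0 \<le> d j" if "j < n" for j using dj[OF that] by (simp add: sum_nonneg)
  have Y0: "Y $$ (k, j) = 0" if "d j = 0" "j < n" "k < m" for j k
    using that dj[OF that(2)] by (simp add: sum_nonneg_eq_0_iff)
  \<comment> \<open>Pseudoinverse of the singular values \<open>r\<close>: a column of
    \<open>Y\<close> with d j = 0 vanishes and stays zero in \<open>Yh\<close>, all others are
    normalized. So \<open>Yh\<close> is a partial isometry with the range of
    \<open>Y\<close>.\<close>
  define c where "c = (\<lambda>j. if d j = 0 then 0 else complex_of_real (1 / sqrt (d j)))"
  define r where "r = (\<lambda>j. complex_of_real (sqrt (d j)))"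
  define Yh where "Yh = Y * mat_diag n c"
  have Yh: "Yh \<in> carrier_mat m n" using Y by (simp add: Yh_def)
  have aYh: "mat_adjoint Yh \<in> carrier_mat n m" using Yh by simp
  have adjYh: "mat_adjoint Yh = mat_diag n c * mat_adjoint Y"
    unfolding Yh_def adj_mult[OF Y mat_diag_dim] by (simp add: adj_diag c_def if_distrib cong: if_cong)
  have YhY: "mat_adjoint Yh * Y = mat_diag n r"
  proof -
    have "mat_adjoint Yh * Y = mat_diag n c * diag_of_reals n d"
      unfolding adjYh by (simp add: assoc_mult_mat[OF mat_diag_dim aY Y] YY)
    also have "\<dots> = mat_diag n (\<lambda>j. c j * of_real (d j))"
      unfolding diag_of_reals_def by (rule mat_diag_diag)
    also have "\<dots> = mat_diag n r"
      by (rule eq_matI) (auto simp: mat_diag_index c_def r_def real_div_sqrt d simp flip: of_real_mult of_real_divide)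
    finally show ?thesis .
  qed
  have Yh_r: "Yh * mat_diag n r = Y"
    using Y Yh Y0 d by (intro eq_matI)
      (auto simp: Yh_def mult_mat_diag_index c_def r_def simp del: index_mult_mat(1))
  have Yh_c: "Yh * (mat_diag n r * mat_diag n c) = Yh"
    unfolding assoc_mult_mat[OF Yh mat_diag_dim mat_diag_dim, symmetric] Yh_r Yh_def[symmetric] ..
  \<comment> \<open>The orthogonal projection onto the range of \<open>Y\<close>, which is that of
    \<open>B\<close> because \<open>V\<close> is unitary.\<close>
  define P where "P = Yh * mat_adjoint Yh"
  have P: "P \<in> carrier_mat m m" using Yh by (simp add: P_def)
  have adjP: "mat_adjoint P = P" unfolding P_def adj_mult[OF Yh aYh] by simp
  have YhYh: "mat_adjoint Yh * Yh = mat_diag n r * mat_diag n c"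
    by (subst (2) Yh_def) (simp add: YhY[symmetric] assoc_mult_mat[OF aYh Y mat_diag_dim])
  have PYh: "P * Yh = Yh"
    unfolding P_def assoc_mult_mat[OF Yh aYh Yh] YhYh Yh_c ..
  have PP: "P * P = P"
    by (subst (2 3) P_def) (simp add: PYh flip: assoc_mult_mat[OF P Yh aYh])
  have PY: "P * Y = Y"
    unfolding P_def assoc_mult_mat[OF Yh aYh Y] YhY Yh_r ..
  define R where "R = 1\<^sub>m m - P"
  have R: "R \<in> carrier_mat m m" using minus_carrier_mat[OF P] by (simp add: R_def)
  have adjR: "mat_adjoint R = R"
  proof (rule eq_matI)
    fix i j assume "i < dim_row R" "j < dim_col R"
    then have ij: "i < m" "j < m" using R by auto
    then show "mat_adjoint R $$ (i, j) = R $$ (i, j)"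
      using arg_cong[OF adjP, of "\<lambda>X. X $$ (i, j)"] P R by (simp add: adj_index) (simp add: R_def)
  qed (use R in auto)
  have RR: "R * R = R"
  proof -
    have "R * R = R * 1\<^sub>m m - R * P"
      by (subst (2) R_def) (rule mult_minus_distrib_mat[OF R one_carrier_mat P])
    also have "R * P = 1\<^sub>m m * P - P * P"
      unfolding R_def by (rule minus_mult_distrib_mat[OF one_carrier_mat P P])
    also have "\<dots> = 0\<^sub>m m m" using P by (simp add: PP)
    finally show ?thesis using R by (auto intro!: eq_matI)
  qed
  have RY: "R * Y = 0\<^sub>m m n"
    unfolding R_def minus_mult_distrib_mat[OF one_carrier_mat P Y] PY using Y by simp
  \<comment> \<open>The rows [Yh, R] and [V, 0], written with empty lower blocks. The first is a
    coisometry because P + R = 1, and the columns of \<open>R\<close> add only zeros to the diagonal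
    form because R Y = 0.\<close>
  let ?U = "four_block_mat Yh R (0\<^sub>m 0 n) (0\<^sub>m 0 m)"
  let ?V = "four_block_mat V (0\<^sub>m n m) (0\<^sub>m 0 n) (0\<^sub>m 0 m)"
  note zc = zero_carrier_mat
  have aV: "mat_adjoint ?V = four_block_mat (mat_adjoint V) (0\<^sub>m n 0) (0\<^sub>m m n) (0\<^sub>m m 0)"
    unfolding adj_four_block[OF v(1) zc zc zc] by simp
  have aU: "mat_adjoint ?U = four_block_mat (mat_adjoint Yh) (0\<^sub>m n 0) R (0\<^sub>m m 0)"
    unfolding adj_four_block[OF Yh R zc zc] adjR by simp
  have "R + P = 1\<^sub>m m" unfolding R_def using P by (auto intro!: eq_matI)
  then have sum1: "P + R = 1\<^sub>m m" using comm_add_mat[OF P R] by simp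
  show thesis
  proof
    show "?U \<in> carrier_mat m (n + m)" using four_block_carrier_mat[OF Yh zc, of R "0\<^sub>m 0 n" 0 m] by simp
    show "?V \<in> carrier_mat n (n + m)" using four_block_carrier_mat[OF v(1) zc, of "0\<^sub>m n m" "0\<^sub>m 0 n" 0 m] by simp
    have "?U * mat_adjoint ?U = four_block_mat (Yh * mat_adjoint Yh + R * R) (Yh * 0\<^sub>m n 0 + R * 0\<^sub>m m 0)
        (0\<^sub>m 0 n * mat_adjoint Yh + 0\<^sub>m 0 m * R) (0\<^sub>m 0 n * 0\<^sub>m n 0 + 0\<^sub>m 0 m * 0\<^sub>m m 0)"
      unfolding aU by (rule mult_four_block_mat[OF Yh R zc zc aYh zc R zc])
    also have "\<dots> = 1\<^sub>m m"
      unfolding RR P_def[symmetric] sum1 using Yh R by (auto intro!: eq_matI)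
    finally show "?U * mat_adjoint ?U = 1\<^sub>m m" .
    have "?V * mat_adjoint ?V = four_block_mat (V * mat_adjoint V + 0\<^sub>m n m * 0\<^sub>m m n) (V * 0\<^sub>m n 0 + 0\<^sub>m n m * 0\<^sub>m m 0)
        (0\<^sub>m 0 n * mat_adjoint V + 0\<^sub>m 0 m * 0\<^sub>m m n) (0\<^sub>m 0 n * 0\<^sub>m n 0 + 0\<^sub>m 0 m * 0\<^sub>m m 0)"
      unfolding aV by (rule mult_four_block_mat[OF v(1) zc zc zc v(2) zc zc zc])
    also have "\<dots> = 1\<^sub>m n"
      unfolding v(4) using v(1,2) by (auto intro!: eq_matI)
    finally show "?V * mat_adjoint ?V = 1\<^sub>m n" .
    have BV': "B * ?V = four_block_mat Y (0\<^sub>m m m) (0\<^sub>m 0 n) (0\<^sub>m 0 m)"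
    proof -
      have "B = four_block_mat B (0\<^sub>m m 0) (0\<^sub>m 0 n) (0\<^sub>m 0 0)" using B by (auto intro!: eq_matI)
      then have "B * ?V = four_block_mat (B * V + 0\<^sub>m m 0 * 0\<^sub>m 0 n) (B * 0\<^sub>m n m + 0\<^sub>m m 0 * 0\<^sub>m 0 m)
          (0\<^sub>m 0 n * V + 0\<^sub>m 0 0 * 0\<^sub>m 0 n) (0\<^sub>m 0 n * 0\<^sub>m n m + 0\<^sub>m 0 0 * 0\<^sub>m 0 m)"
        using mult_four_block_mat[OF B zc zc zc v(1) zc zc zc] by metis
      then show ?thesis using B v(1) Y by (simp add: Y_def)
    qed
    have "mat_adjoint ?U * (B * ?V) = four_block_mat (mat_adjoint Yh * Y + 0\<^sub>m n 0 * 0\<^sub>m 0 n) (mat_adjoint Yh * 0\<^sub>m m m + 0\<^sub>m n 0 * 0\<^sub>m 0 m)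
        (R * Y + 0\<^sub>m m 0 * 0\<^sub>m 0 n) (R * 0\<^sub>m m m + 0\<^sub>m m 0 * 0\<^sub>m 0 m)"
      unfolding aU BV' by (rule mult_four_block_mat[OF aYh zc R zc Y zc zc zc])
    also have "\<dots> = four_block_mat (mat_diag n r) (0\<^sub>m n m) (0\<^sub>m m n) (0\<^sub>m m m)"
      unfolding YhY RY using aYh R by (simp add: right_add_zero_mat[OF mat_diag_dim] right_mult_zero_mat[OF aYh])
    also have "\<dots> = mat_diag (n + m) (\<lambda>j. of_real (if j < n then sqrt (d j) else 0))"
      by (rule eq_matI) (auto simp: mat_diag_index r_def)
    finally show "mat_adjoint ?U * (B * ?V) = mat_diag (n + m) (\<lambda>j. of_real (if j < n then sqrt (d j) else 0))" .
  qed
qed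

section \<open>Determinants of lower triangular block matrices\<close>

definition gram_det :: "complex mat \<Rightarrow> complex" where
  "gram_det M = det (1\<^sub>m (dim_row M) + M * mat_adjoint M)"

lemma gram_det_adjoint: "gram_det (mat_adjoint M) = gram_det M"
  unfolding gram_det_def adj_adj adj_dim
  by (rule det_one_plus_commute) auto

lemma mult_coisometry_gram:
  fixes M V :: "complex mat"
  assumes M: "M \<in> carrier_mat m n" and V: "V \<in> carrier_mat n k" and VV: "V * mat_adjoint V = 1\<^sub>m n"
  shows "(M * V) * mat_adjoint (M * V) = M * mat_adjoint M"
proof -
  have aV: "mat_adjoint V \<in> carrier_mat k n" and aM: "mat_adjoint M \<in> carrier_mat n m" using M V by auto
  have "(M * V) * (mat_adjoint V * mat_adjoint M) = M * ((V * mat_adjoint V) * mat_adjoint M)"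
    unfolding assoc_mult_mat[OF M V mult_carrier_mat[OF aV aM]] assoc_mult_mat[OF V aV aM] ..
  then show ?thesis
    unfolding adj_mult[OF M V] VV using left_mult_one_mat[OF aM] by simp
qed

lemma gram_det_mult_coisometry:
  fixes M V :: "complex mat"
  assumes "M \<in> carrier_mat m n" "V \<in> carrier_mat n k" "V * mat_adjoint V = 1\<^sub>m n"
  shows "gram_det (M * V) = gram_det M"
  unfolding gram_det_def mult_coisometry_gram[OF assms] by simp

lemma gram_det_isometry_mult:
  fixes M L :: "complex mat"
  assumes M: "M \<in> carrier_mat m n" and L: "L \<in> carrier_mat k m" and LL: "mat_adjoint L * L = 1\<^sub>m m"
  shows "gram_det (L * M) = gram_det M"
proof -
  have "gram_det (mat_adjoint M * mat_adjoint L) = gram_det (mat_adjoint M)"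
    using M L LL by (intro gram_det_mult_coisometry[of _ n m _ k]) auto
  then have "gram_det (mat_adjoint (L * M)) = gram_det (mat_adjoint M)" by (simp add: adj_mult[OF L M])
  then show ?thesis by (simp add: gram_det_adjoint)
qed

lemma frob2_mult_coisometry:
  fixes M V :: "complex mat"
  assumes "M \<in> carrier_mat m n" "V \<in> carrier_mat n k" "V * mat_adjoint V = 1\<^sub>m n"
  shows "frob2 (M * V) = frob2 M"
  using frob2_trace[of "M * V"] frob2_trace[of M] unfolding mult_coisometry_gram[OF assms] by (metis of_real_eq_iff)

lemma frob2_isometry_mult:
  fixes M L :: "complex mat"
  assumes M: "M \<in> carrier_mat m n" and L: "L \<in> carrier_mat k m" and LL: "mat_adjoint L * L = 1\<^sub>m m"
  shows "frob2 (L * M) = frob2 M"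
proof -
  have "frob2 (mat_adjoint M * mat_adjoint L) = frob2 (mat_adjoint M)"
    using M L LL by (intro frob2_mult_coisometry[of _ n m _ k]) auto
  then have "frob2 (mat_adjoint (L * M)) = frob2 (mat_adjoint M)" by (simp add: adj_mult[OF L M])
  then show ?thesis by (simp add: frob2_adjoint)
qed

lemma adj_smult_real:
  fixes M :: "complex mat"
  shows "mat_adjoint (of_real c \<cdot>\<^sub>m M) = of_real c \<cdot>\<^sub>m mat_adjoint M"
  by (rule eq_matI) (auto simp: adj_index)

lemma gram_det_smult:
  fixes M :: "complex mat"
  assumes M: "M \<in> carrier_mat m n" and t: "0 \<le> t"
  shows "gram_det (of_real (sqrt t) \<cdot>\<^sub>m M) = det (1\<^sub>m m + of_real t \<cdot>\<^sub>m (M * mat_adjoint M))"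
proof -
  have "(of_real (sqrt t) \<cdot>\<^sub>m M) * (of_real (sqrt t) \<cdot>\<^sub>m mat_adjoint M)
      = (of_real (sqrt t) * of_real (sqrt t)) \<cdot>\<^sub>m (M * mat_adjoint M)"
    using M by (intro eq_matI) (auto simp: mult_ac)
  also have "of_real (sqrt t) * of_real (sqrt t) = (of_real t :: complex)"
    using t by (simp flip: of_real_mult)
  finally show ?thesis using M by (simp add: gram_det_def adj_smult_real)
qed

lemma gram_det_nonzero: "gram_det M \<noteq> 0"
proof -
  have M: "M \<in> carrier_mat (dim_row M) (dim_col M)" by simp
  obtain d where d: "\<forall>i<dim_row M. 0 \<le> d i"
    and det: "\<forall>t. det (1\<^sub>m (dim_row M) + of_real t \<cdot>\<^sub>m (M * mat_adjoint M)) = of_real (\<Prod>i<dim_row M. 1 + t * d i)"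
    using gram_eigenvalues[OF M] by auto
  have "of_real 1 \<cdot>\<^sub>m (M * mat_adjoint M) = M * mat_adjoint M" by (rule eq_matI) auto
  then have "gram_det M = of_real (\<Prod>i<dim_row M. 1 + 1 * d i)"
    using det[rule_format, of 1] unfolding gram_det_def by simp
  moreover have "0 < (\<Prod>i<dim_row M. 1 + 1 * d i)" using d by (intro prod_pos) (auto intro!: add_pos_nonneg)
  ultimately show ?thesis by (metis less_irrefl of_real_eq_0_iff)
qed

text \<open>Both determinants reduce to the same Schur complement. With U solving (1 + D D') U = B,
  where D' and B' denote adjoints, each equals det (1 + A' A + B' U) times det (1 + D D').\<close>

lemma gram_det_lower_block:
  fixes A B D :: "complex mat"
  assumes A: "A \<in> carrier_mat r n" and B: "B \<in> carrier_mat p n" and D: "D \<in> carrier_mat p c"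
  shows "gram_det (four_block_mat A (0\<^sub>m r c) B D)
    = det (four_block_mat (1\<^sub>m n + mat_adjoint A * A) (- mat_adjoint B) B (1\<^sub>m p + D * mat_adjoint D))"
proof -
  let ?X = "1\<^sub>m n + mat_adjoint A * A" and ?Z = "1\<^sub>m p + D * mat_adjoint D"
  let ?T = "four_block_mat A (0\<^sub>m r c) B D"
  have aA: "mat_adjoint A \<in> carrier_mat n r" and aB: "mat_adjoint B \<in> carrier_mat n p"
    and aD: "mat_adjoint D \<in> carrier_mat c p" using A B D by auto
  have X: "?X \<in> carrier_mat n n" and Z: "?Z \<in> carrier_mat p p" using A D by auto
  have AA: "mat_adjoint A * A \<in> carrier_mat n n" and BB: "mat_adjoint B * B \<in> carrier_mat n n"
    and DD: "mat_adjoint D * D \<in> carrier_mat c c" and D'D: "D * mat_adjoint D \<in> carrier_mat p p"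
    using mult_carrier_mat[OF aA A] mult_carrier_mat[OF aB B] mult_carrier_mat[OF aD D] mult_carrier_mat[OF D aD] by auto
  have nz: "det ?Z \<noteq> 0" using gram_det_nonzero[of D] D by (simp add: gram_det_def)
  define U where "U = (1 / det ?Z) \<cdot>\<^sub>m (adj_mat ?Z * B)"
  note aZ = adj_mat[OF Z]
  have U: "U \<in> carrier_mat p n" using aZ(1) B by (simp add: U_def)
  have ZU: "?Z * U = B"
  proof -
    have "?Z * U = (1 / det ?Z) \<cdot>\<^sub>m (?Z * (adj_mat ?Z * B))"
      unfolding U_def by (rule mult_smult_distrib[OF Z mult_carrier_mat[OF aZ(1) B]])
    also have "?Z * (adj_mat ?Z * B) = (det ?Z \<cdot>\<^sub>m 1\<^sub>m p) * B"
      unfolding assoc_mult_mat[OF Z aZ(1) B, symmetric] aZ(2) ..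
    also have "\<dots> = det ?Z \<cdot>\<^sub>m B"
      unfolding mult_smult_assoc_mat[OF one_carrier_mat B] left_mult_one_mat[OF B] ..
    finally show ?thesis using nz B by (auto intro!: eq_matI)
  qed
  have aDU: "mat_adjoint D * U \<in> carrier_mat c n" using mult_carrier_mat[OF aD U] .
  have aBU: "mat_adjoint B * U \<in> carrier_mat n n" using mult_carrier_mat[OF aB U] .
  \<comment> \<open>From (1 + D D') U = B, with D' the adjoint of D, it follows that D D' U = B -
    U.\<close>
  have BU: "mat_adjoint B * D * (mat_adjoint D * U) = mat_adjoint B * B - mat_adjoint B * U"
  proof -
    have "U + D * (mat_adjoint D * U) = B"
      using ZU unfolding add_mult_distrib_mat[OF one_carrier_mat D'D U] left_mult_one_mat[OF U] assoc_mult_mat[OF D aD U] .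
    then have "mat_adjoint B * U + mat_adjoint B * (D * (mat_adjoint D * U)) = mat_adjoint B * B"
      using mult_add_distrib_mat[OF aB U mult_carrier_mat[OF D aDU]] by simp
    then have "mat_adjoint B * U + mat_adjoint B * D * (mat_adjoint D * U) = mat_adjoint B * B"
      unfolding assoc_mult_mat[OF aB D aDU] .
    moreover have "Q = S - P" if "P + Q = S" "P \<in> carrier_mat n n" "Q \<in> carrier_mat n n" for P Q S :: "complex mat"
      using that by (auto intro!: eq_matI)
    ultimately show ?thesis
      using aBU mult_carrier_mat[OF mult_carrier_mat[OF aB D] aDU] by blast
  qed
  have T: "?T \<in> carrier_mat (r + p) (n + c)" using A D by simp
  have aT: "mat_adjoint ?T = four_block_mat (mat_adjoint A) (mat_adjoint B) (0\<^sub>m c r) (mat_adjoint D)"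
    unfolding adj_four_block[OF A zero_carrier_mat B D] by simp
  have "gram_det ?T = gram_det (mat_adjoint ?T)" by (rule gram_det_adjoint[symmetric])
  also have "\<dots> = det (1\<^sub>m (n + c) + mat_adjoint ?T * ?T)"
    unfolding gram_det_def adj_dim carrier_matD(2)[OF T] adj_adj ..
  also have "mat_adjoint ?T * ?T = four_block_mat (mat_adjoint A * A + mat_adjoint B * B) (mat_adjoint A * 0\<^sub>m r c + mat_adjoint B * D)
      (0\<^sub>m c r * A + mat_adjoint D * B) (0\<^sub>m c r * 0\<^sub>m r c + mat_adjoint D * D)"
    unfolding aT by (rule mult_four_block_mat[OF aA aB zero_carrier_mat aD A zero_carrier_mat B D])
  also have "\<dots> = four_block_mat (mat_adjoint A * A + mat_adjoint B * B) (mat_adjoint B * D) (mat_adjoint D * B) (mat_adjoint D * D)"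
    using right_mult_zero_mat[OF aA, of c] left_mult_zero_mat[OF A, of c]
      left_add_zero_mat[OF mult_carrier_mat[OF aB D]] left_add_zero_mat[OF mult_carrier_mat[OF aD B]] left_add_zero_mat[OF DD]
    by simp
  also have "1\<^sub>m (n + c) + \<dots> = four_block_mat (1\<^sub>m n + (mat_adjoint A * A + mat_adjoint B * B)) (mat_adjoint B * D) (mat_adjoint D * B) (1\<^sub>m c + mat_adjoint D * D)"
    using A B D by (intro eq_matI) auto
  also have "det \<dots> = det (1\<^sub>m n + (mat_adjoint A * A + mat_adjoint B * B) - mat_adjoint B * D * (mat_adjoint D * U)) * det (1\<^sub>m c + mat_adjoint D * D)"
  proof (rule det_schur_complement[OF _ mult_carrier_mat[OF aB D] mult_carrier_mat[OF aD B] _ aDU])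
    \<comment> \<open>Push-through identity: (1 + D' D) D' = D' (1 + D D'), where D' is the adjoint
      of D, turns a solution for \<open>?Z\<close> into one for the lower right block.\<close>
    have "(1\<^sub>m c + mat_adjoint D * D) * (mat_adjoint D * U) = mat_adjoint D * U + mat_adjoint D * D * (mat_adjoint D * U)"
      unfolding add_mult_distrib_mat[OF one_carrier_mat DD aDU] left_mult_one_mat[OF aDU] ..
    also have "mat_adjoint D * D * (mat_adjoint D * U) = mat_adjoint D * (D * mat_adjoint D * U)"
      unfolding assoc_mult_mat[OF aD D aDU] assoc_mult_mat[OF D aD U] ..
    also have "mat_adjoint D * U + \<dots> = mat_adjoint D * (?Z * U)"
      unfolding add_mult_distrib_mat[OF one_carrier_mat D'D U] left_mult_one_mat[OF U]
        mult_add_distrib_mat[OF aD U mult_carrier_mat[OF D'D U]] ..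
    finally show "(1\<^sub>m c + mat_adjoint D * D) * (mat_adjoint D * U) = mat_adjoint D * B" unfolding ZU .
  qed (use AA BB DD in auto)
  also have "1\<^sub>m n + (mat_adjoint A * A + mat_adjoint B * B) - mat_adjoint B * D * (mat_adjoint D * U) = ?X - - mat_adjoint B * U"
    unfolding BU using AA BB aBU A B U by (intro eq_matI) auto
  also have "det (1\<^sub>m c + mat_adjoint D * D) = det ?Z" by (rule det_one_plus_commute[OF aD D])
  also have "det (?X - - mat_adjoint B * U) * det ?Z = det (four_block_mat ?X (- mat_adjoint B) B ?Z)"
    using det_schur_complement[OF X _ B Z U ZU, of "- mat_adjoint B"] aB by simp
  finally show ?thesis .
qed

text \<open>\<open>block_det_pinching\<close> is applied with the adjoints of \<open>D\<close> and
  \<open>A\<close> in the places of \<open>A\<close> and \<open>D\<close>, and with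
  \<open>- b\<close>. The exchange puts the block of A in the upper left corner, the sign matches
  the coupling.\<close>

lemma gram_det_lower_block_ge:
  fixes A D :: "complex mat"
  assumes A: "A \<in> carrier_mat r n" and D: "D \<in> carrier_mat n c"
  shows "cmod (gram_det A) * cmod (gram_det D) *
      (\<Prod>j<n. 1 + (b j)\<^sup>2 / ((1 + (\<Sum>k<r. (cmod (A $$ (k, j)))\<^sup>2)) * (1 + (\<Sum>k<c. (cmod (D $$ (j, k)))\<^sup>2))))
    \<le> cmod (gram_det (four_block_mat A (0\<^sub>m r c) (mat_diag n (\<lambda>j. of_real (b j))) D))"
proof -
  have aA: "mat_adjoint A \<in> carrier_mat n r" and aD: "mat_adjoint D \<in> carrier_mat c n" using A D by auto
  have gA: "det (1\<^sub>m n + mat_adjoint A * mat_adjoint (mat_adjoint A)) = gram_det A"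
    using gram_det_adjoint[of A] A by (simp add: gram_det_def)
  have gD: "det (1\<^sub>m n + mat_adjoint (mat_adjoint D) * mat_adjoint D) = gram_det D"
    using D by (simp add: gram_det_def)
  have prods: "(\<Prod>j<n. 1 + (- b j)\<^sup>2 / ((1 + (\<Sum>k<c. (cmod (mat_adjoint D $$ (k, j)))\<^sup>2)) * (1 + (\<Sum>k<r. (cmod (mat_adjoint A $$ (j, k)))\<^sup>2))))
    = (\<Prod>j<n. 1 + (b j)\<^sup>2 / ((1 + (\<Sum>k<r. (cmod (A $$ (k, j)))\<^sup>2)) * (1 + (\<Sum>k<c. (cmod (D $$ (j, k)))\<^sup>2))))"
    using A D by (intro prod.cong) (auto simp: adj_index mult.commute)
  have K: "- mat_adjoint (mat_diag n (\<lambda>j. complex_of_real (b j))) = mat_diag n (\<lambda>j. of_real (- b j))"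
    "mat_diag n (\<lambda>j. - complex_of_real (- b j)) = mat_diag n (\<lambda>j. of_real (b j))"
    by (auto simp: adj_diag mat_diag_index intro!: eq_matI)
  show ?thesis
    using block_det_pinching[OF aD aA, of "\<lambda>j. - b j"]
    unfolding gA gD prods K(2) unfolding gram_det_lower_block[OF A mat_diag_dim D] K(1) by simp
qed

lemma gram_det_diag:
  "gram_det (mat_diag n (\<lambda>j. of_real (b j))) = of_real (\<Prod>j<n. 1 + (b j)\<^sup>2)"
proof -
  have one: "unitary_mat n (1\<^sub>m n)" by (simp add: unitary_mat_def)
  have "mat_diag n (\<lambda>j. complex_of_real (b j)) * mat_adjoint (mat_diag n (\<lambda>j. of_real (b j)))
      = 1\<^sub>m n * diag_of_reals n (\<lambda>j. (b j)\<^sup>2) * mat_adjoint (1\<^sub>m n)"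
    unfolding adj_diag mat_diag_diag adj_one right_mult_one_mat[OF mult_carrier_mat[OF one_carrier_mat diag_of_reals_carrier]]
      left_mult_one_mat[OF diag_of_reals_carrier]
    by (simp add: diag_of_reals_def power2_eq_square)
  then show ?thesis unfolding gram_det_def using det_unitary_conj[OF one, of "\<lambda>j. (b j)\<^sup>2"] by simp
qed

lemma frob2_diag: "frob2 (mat_diag n (\<lambda>j. of_real (b j))) = (\<Sum>j<n. (b j)\<^sup>2)"
proof -
  have "(\<Sum>j<n. (cmod (mat_diag n (\<lambda>j. complex_of_real (b j)) $$ (i, j)))\<^sup>2) = (b i)\<^sup>2" if "i < n" for i
  proof -
    have "(\<Sum>j<n. (cmod (mat_diag n (\<lambda>j. complex_of_real (b j)) $$ (i, j)))\<^sup>2) = (\<Sum>j<n. if j = i then (b i)\<^sup>2 else 0)"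
      using that by (intro sum.cong) (auto simp: mat_diag_index)
    then show ?thesis using that by simp
  qed
  then show ?thesis by (simp add: frob2_def)
qed

section \<open>From determinant comparison to entropy comparison\<close>

definition weighted_list :: "real \<Rightarrow> nat \<Rightarrow> (nat \<Rightarrow> real) \<Rightarrow> (real \<times> real) list" where
  "weighted_list c n x = map (\<lambda>i. (c, x i)) [0..<n]"

lemma sum_weighted_list: "(\<Sum>(c, x)\<leftarrow>weighted_list c n x. c * f x) = c * (\<Sum>i<n. f (x i))"
  by (simp add: weighted_list_def o_def interv_sum_list_conv_sum_set_nat sum_distrib_left lessThan_atLeast0)

lemma set_weighted_list: "(c', y) \<in> set (weighted_list c n x) \<longleftrightarrow> c' = c \<and> (\<exists>i<n. y = x i)"
  by (auto simp: weighted_list_def)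

lemma ln_prod_lessThan:
  fixes f :: "nat \<Rightarrow> real"
  assumes "\<And>i. i < n \<Longrightarrow> 0 < f i"
  shows "ln (\<Prod>i<n. f i) = (\<Sum>i<n. ln (f i))"
  using assms
proof (induction n)
  case (Suc n)
  have "0 < (\<Prod>i<n. f i)" using Suc.prems by (intro prod_pos) auto
  then show ?case using Suc by (simp add: ln_mult_pos)
qed simp

text \<open>Equality of the determinants for all t > 0 replaces a matching of entries, so that
  families of different lengths, differing by zeros and order, can be compared.\<close>

lemma xlnx_sum_mono:
  fixes x y :: "nat \<Rightarrow> real"
  assumes "\<And>i. i < n \<Longrightarrow> 0 \<le> x i" "\<And>j. j < m \<Longrightarrow> 0 \<le> y j" "(\<Sum>i<n. x i) = (\<Sum>j<m. y j)"
    and "\<And>t. 0 < t \<Longrightarrow> (\<Prod>j<m. 1 + t * y j) = (\<Prod>i<n. 1 + t * x i)"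
  shows "(\<Sum>i<n. x i * ln (x i)) \<le> (\<Sum>j<m. y j * ln (y j))"
proof -
  let ?L = "weighted_list 1 n x @ weighted_list (-1) m y"
  have "(\<Sum>(c, x)\<leftarrow>?L. c * (x * ln x)) \<le> 0"
  proof (rule weighted_entropy_from_log_det)
    show "0 \<le> x" if "(c, x) \<in> set ?L" for c x using that assms by (auto simp: set_weighted_list)
    show "(\<Sum>(c, x)\<leftarrow>?L. c * x) = 0" using assms(3) by (simp add: sum_weighted_list[where f = "\<lambda>x. x"])
    fix t :: real assume t: "0 < t"
    have "(\<Sum>i<n. ln (1 + t * x i)) = ln (\<Prod>i<n. 1 + t * x i)"
      using assms(1) t by (subst ln_prod_lessThan) (auto intro!: add_pos_nonneg)
    moreover have "(\<Sum>j<m. ln (1 + t * y j)) = ln (\<Prod>j<m. 1 + t * y j)"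
      using assms(2) t by (subst ln_prod_lessThan) (auto intro!: add_pos_nonneg)
    ultimately show "0 \<le> (\<Sum>(c, x)\<leftarrow>?L. c * ln (1 + t * x))"
      using assms(4)[OF t] by (simp add: sum_weighted_list[where f = "\<lambda>x. ln (1 + t * x)"])
  qed
  then show ?thesis by (simp add: sum_weighted_list[where f = "\<lambda>x. x * ln x"])
qed

text \<open>The logarithm of the j-th coupling factor is the log determinant of the two roots minus
  that of \<open>a j\<close> and \<open>g j\<close>. The hypothesis \<open>det\<close> is therefore
  a signed comparison of spectra, and superadditivity then merges the triples.\<close>

lemma entropy_from_lower_block_dets:
  fixes a b g p q s :: "nat \<Rightarrow> real"
  assumes nn: "\<And>i. i < nS \<Longrightarrow> 0 \<le> s i" "\<And>i. i < nA \<Longrightarrow> 0 \<le> p i" "\<And>i. i < nD \<Longrightarrow> 0 \<le> q i"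
    and ag: "\<And>j. 0 \<le> a j" "\<And>j. 0 \<le> g j"
    and sums: "(\<Sum>i<nA. p i) = (\<Sum>j<N. a j)" "(\<Sum>i<nD. q i) = (\<Sum>j<N. g j)"
      "(\<Sum>i<nS. s i) = (\<Sum>j<N. a j) + (\<Sum>j<N. (b j)\<^sup>2) + (\<Sum>j<N. g j)"
    and det: "\<And>t. 0 < t \<Longrightarrow> (\<Prod>i<nA. 1 + t * p i) * (\<Prod>i<nD. 1 + t * q i)
      * (\<Prod>j<N. 1 + t * (b j)\<^sup>2 / ((1 + t * a j) * (1 + t * g j))) \<le> (\<Prod>i<nS. 1 + t * s i)"
  shows "(\<Sum>i<nS. s i * ln (s i)) - (\<Sum>i<nA. p i * ln (p i)) - (\<Sum>i<nD. q i * ln (q i)) - (\<Sum>j<N. (b j)\<^sup>2 * ln ((b j)\<^sup>2))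
    \<le> entropy_gap (\<Sum>j<N. a j) (\<Sum>j<N. (b j)\<^sup>2) (\<Sum>j<N. g j)"
proof -
  let ?R = "\<lambda>j. big_root (a j) ((b j)\<^sup>2) (g j)" and ?r = "\<lambda>j. small_root (a j) ((b j)\<^sup>2) (g j)"
  have rn: "0 \<le> ?R j" "0 \<le> ?r j" for j using roots_nonneg ag by simp_all
  \<comment> \<open>The squares of \<open>b\<close> enter only through the roots. The first moments
    cancel since each pair of roots sums to a + b^2 + g, and the terms in ln (b^2) are subtracted
    from both sides afterwards.\<close>
  let ?L = "weighted_list 1 nS s @ weighted_list (-1) nA p @ weighted_list (-1) nD q
    @ weighted_list (-1) N ?R @ weighted_list (-1) N ?r @ weighted_list 1 N a @ weighted_list 1 N g"
  have "(\<Sum>(c, x)\<leftarrow>?L. c * (x * ln x)) \<le> 0"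
  proof (rule weighted_entropy_from_log_det)
    show "0 \<le> x" if "(c, x) \<in> set ?L" for c x
      using that nn ag rn by (auto simp: set_weighted_list)
    have "(\<Sum>j<N. ?R j) + (\<Sum>j<N. ?r j) = (\<Sum>j<N. a j) + (\<Sum>j<N. (b j)\<^sup>2) + (\<Sum>j<N. g j)"
      unfolding sum.distrib[symmetric] roots_sum ..
    then show "(\<Sum>(c, x)\<leftarrow>?L. c * x) = 0"
      using sums by (simp add: sum_weighted_list[where f = "\<lambda>x. x"])
    fix t :: real assume t: "0 < t"
    have pos: "0 < 1 + t * x" if "0 \<le> x" for x using that t by (simp add: add_pos_nonneg)
    have lnp: "ln (\<Prod>i<n. 1 + t * f i) = (\<Sum>i<n. ln (1 + t * f i))" if "\<And>i. i < n \<Longrightarrow> 0 \<le> f i" for n :: nat and f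
      using that by (subst ln_prod_lessThan) (auto intro!: pos)
    let ?c = "\<lambda>j. 1 + t * (b j)\<^sup>2 / ((1 + t * a j) * (1 + t * g j))"
    have c: "0 < ?c j" for j
    proof -
      have "0 \<le> t * (b j)\<^sup>2 / ((1 + t * a j) * (1 + t * g j))"
        by (rule divide_nonneg_pos[OF _ mult_pos_pos[OF pos[OF ag(1)] pos[OF ag(2)]]]) (use t in simp)
      then show ?thesis by linarith
    qed
    have lnc: "ln (?c j) = ln (1 + t * ?R j) + ln (1 + t * ?r j) - ln (1 + t * a j) - ln (1 + t * g j)" for j
    proof -
      have p: "0 < 1 + t * a j" "0 < 1 + t * g j" using pos ag by auto
      have "?c j = ((1 + t * a j) * (1 + t * g j) + t * (b j)\<^sup>2) / ((1 + t * a j) * (1 + t * g j))"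
        using p by (simp add: add_divide_distrib)
      moreover have "0 < (1 + t * a j) * (1 + t * g j) + t * (b j)\<^sup>2"
        by (rule add_pos_nonneg[OF mult_pos_pos[OF p]]) (use t in simp)
      ultimately have "ln (?c j) = ln ((1 + t * a j) * (1 + t * g j) + t * (b j)\<^sup>2) - (ln (1 + t * a j) + ln (1 + t * g j))"
        using p by (simp only: ln_divide_pos mult_pos_pos ln_mult_pos)
      then show ?thesis using ln_roots[OF ag(1)[of j] zero_le_power2 ag(2)[of j] t] by simp
    qed
    let ?P = "(\<Prod>i<nA. 1 + t * p i)" and ?Q = "(\<Prod>i<nD. 1 + t * q i)" and ?C = "(\<Prod>j<N. ?c j)"
    have PQC: "0 < ?P" "0 < ?Q" "0 < ?C" using nn c by (auto intro!: prod_pos pos)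
    have "(\<Sum>i<nA. ln (1 + t * p i)) + (\<Sum>i<nD. ln (1 + t * q i)) + (\<Sum>j<N. ln (?c j)) = ln (?P * ?Q * ?C)"
      using PQC nn by (simp only: lnp ln_prod_lessThan c ln_mult_pos mult_pos_pos)
    also have "\<dots> \<le> ln (\<Prod>i<nS. 1 + t * s i)"
      by (rule ln_mono[OF det[OF t] mult_pos_pos[OF mult_pos_pos[OF PQC(1,2)] PQC(3)]])
    also have "\<dots> = (\<Sum>i<nS. ln (1 + t * s i))" using nn by (simp add: lnp)
    finally show "0 \<le> (\<Sum>(c, x)\<leftarrow>?L. c * ln (1 + t * x))"
      unfolding lnc by (simp add: sum_weighted_list[where f = "\<lambda>x. ln (1 + t * x)"] sum.distrib sum_subtractf)
  qed
  then have "(\<Sum>i<nS. s i * ln (s i)) - (\<Sum>i<nA. p i * ln (p i)) - (\<Sum>i<nD. q i * ln (q i)) - (\<Sum>j<N. (b j)\<^sup>2 * ln ((b j)\<^sup>2))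
      \<le> (\<Sum>j<N. entropy_gap (a j) ((b j)\<^sup>2) (g j))"
    by (simp add: sum_weighted_list[where f = "\<lambda>x. x * ln x"] entropy_gap_def sum.distrib sum_subtractf)
  also have "\<dots> \<le> entropy_gap (\<Sum>j<N. a j) (\<Sum>j<N. (b j)\<^sup>2) (\<Sum>j<N. g j)"
    using ag by (intro entropy_gap_sum) auto
  finally show ?thesis .
qed

section \<open>The entropy inequality\<close>

text \<open>Dividing a spectrum of sum w by w subtracts ln w from each logarithm; after weighting by
  w the total correction is w ln w. At w = 0 all eigenvalues are 0, and both sides vanish.\<close>

lemma gram_spectrum:
  fixes M :: "complex mat"
  assumes M: "M \<in> carrier_mat n m"
  shows "\<exists>d. (\<forall>i<n. 0 \<le> d i) \<and> (\<Sum>i<n. d i) = frob2 M \<and>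
    vn_entropy (M * mat_adjoint M) = - (\<Sum>i<n. d i * ln (d i)) / ln 2 \<and>
    weighted_entropy (frob2 M) M = (frob2 M * ln (frob2 M) - (\<Sum>i<n. d i * ln (d i))) / ln 2 \<and>
    (\<forall>t\<ge>0. gram_det (of_real (sqrt t) \<cdot>\<^sub>m M) = of_real (\<Prod>i<n. 1 + t * d i))"
proof -
  obtain d where d: "\<forall>i<n. 0 \<le> d i" and sum: "(\<Sum>i<n. d i) = frob2 M"
    and entropy: "\<forall>c. vn_entropy (of_real c \<cdot>\<^sub>m (M * mat_adjoint M)) = - (\<Sum>i<n. (c * d i) * log 2 (c * d i))"
    and det: "\<forall>t. det (1\<^sub>m n + of_real t \<cdot>\<^sub>m (M * mat_adjoint M)) = of_real (\<Prod>i<n. 1 + t * d i)"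
    using gram_eigenvalues[OF M] by auto
  show ?thesis
  proof (intro exI[of _ d] conjI allI impI)
    show "0 \<le> d i" if "i < n" for i using d that by blast
    show "(\<Sum>i<n. d i) = frob2 M" by (rule sum)
    have "of_real 1 \<cdot>\<^sub>m (M * mat_adjoint M) = M * mat_adjoint M" by (rule eq_matI) auto
    then show "vn_entropy (M * mat_adjoint M) = - (\<Sum>i<n. d i * ln (d i)) / ln 2"
      using entropy[rule_format, of 1] by (simp add: log_def sum_divide_distrib)
    show "gram_det (of_real (sqrt t) \<cdot>\<^sub>m M) = of_real (\<Prod>i<n. 1 + t * d i)" if "0 \<le> t" for t
      unfolding gram_det_smult[OF M that] using det by blast
    show "weighted_entropy (frob2 M) M = (frob2 M * ln (frob2 M) - (\<Sum>i<n. d i * ln (d i))) / ln 2"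
    proof (cases "frob2 M = 0")
      case True
      then have "\<forall>i<n. d i = 0" using sum d sum_nonneg_eq_0_iff[of "{..<n}" d] by auto
      then show ?thesis using True by (simp add: weighted_entropy_def)
    next
      case False
      define w where "w = frob2 M"
      have w: "0 < w" using False frob2_nonneg[of M] by (simp add: w_def)
      have term_eq: "w * (1 / w * d i * log 2 (1 / w * d i)) = (d i * ln (d i) - d i * ln w) / ln 2" if "i < n" for i
        using d that w by (cases "d i = 0") (auto simp: log_def ln_div field_simps)
      have "weighted_entropy w M = w * vn_entropy (of_real (1 / w) \<cdot>\<^sub>m (M * mat_adjoint M))"
        using w by (simp add: weighted_entropy_def)
      also have "\<dots> = - (\<Sum>i<n. w * (1 / w * d i * log 2 (1 / w * d i)))"
        unfolding entropy[rule_format] sum_distrib_left[symmetric] by simp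
      also have "\<dots> = - (\<Sum>i<n. (d i * ln (d i) - d i * ln w) / ln 2)"
        by (intro arg_cong[where f = uminus] sum.cong refl term_eq) simp
      also have "\<dots> = (w * ln w - (\<Sum>i<n. d i * ln (d i))) / ln 2"
        unfolding sum_divide_distrib[symmetric] sum_subtractf sum_distrib_right[symmetric] sum w_def
        by (simp add: field_simps)
      finally show ?thesis by (simp add: w_def)
    qed
  qed
qed

text \<open>At total weight 1 the discriminant of the roots is 1 - 4 a g, which is
  \<open>1 - c\<^sup>2\<close> for the argument c = 2 sqrt (a g) of \<open>e_fun\<close>; the two
  roots are complementary probabilities.\<close>

lemma e_fun_roots:
  assumes "0 \<le> a" "0 \<le> b" "0 \<le> g" "a + b + g = 1"
  shows "e_fun (2 * sqrt (a * g))
    = - (big_root a b g * ln (big_root a b g) + small_root a b g * ln (small_root a b g)) / ln 2"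
proof -
  have "(2 * sqrt (a * g))\<^sup>2 = 4 * a * g" using assms by (simp add: power_mult_distrib)
  then have big: "(1 + sqrt (1 - (2 * sqrt (a * g))\<^sup>2)) / 2 = big_root a b g"
    using assms by (simp add: big_root_def)
  have small: "1 - big_root a b g = small_root a b g"
    using roots_sum[of a b g] assms by simp
  show ?thesis
    unfolding e_fun_def big h2_def small by (simp add: log_def add_divide_distrib diff_divide_distrib)
qed

lemma frob2_lower_block:
  assumes A: "A \<in> carrier_mat r1 c1" and B: "B \<in> carrier_mat r2 c1" and D: "D \<in> carrier_mat r2 c2"
  shows "frob2 (four_block_mat A (0\<^sub>m r1 c2) B D) = frob2 A + frob2 B + frob2 D"
  using A B D by (simp add: frob2_def sum_lessThan_add sum.distrib)

theorem theorem4p2: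
  fixes A B D T :: "complex mat" and r1 r2 c1 c2 :: nat and \<alpha> \<beta> \<gamma> :: real
  assumes "r1 > 0" "r2 > 0" "c1 > 0" "c2 > 0"
    and "A \<in> carrier_mat r1 c1"
    and "B \<in> carrier_mat r2 c1"
    and "D \<in> carrier_mat r2 c2"
    and "T = four_block_mat A (0\<^sub>m r1 c2) B D"
    and "\<alpha> = (frob_norm A)\<^sup>2"
    and "\<beta> = (frob_norm B)\<^sup>2"
    and "\<gamma> = (frob_norm D)\<^sup>2"
    and "\<alpha> + \<beta> + \<gamma> = 1"
  shows "vn_entropy (T * mat_adjoint T) \<ge>
    e_fun (2 * sqrt (\<alpha> * \<gamma>))
      + weighted_entropy \<alpha> A + weighted_entropy \<beta> B + weighted_entropy \<gamma> D"
proof -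
  note A = assms(5) and B = assms(6) and D = assms(7) and T_def = assms(8)
  have weights: "\<alpha> = frob2 A" "\<beta> = frob2 B" "\<gamma> = frob2 D"
    using assms(9-11) by (simp_all add: frob_norm_square)
  have T: "T \<in> carrier_mat (r1 + r2) (c1 + c2)" using A D by (simp add: T_def)
  obtain p where "\<forall>i<r1. 0 \<le> p i" "(\<Sum>i<r1. p i) = frob2 A"
      "vn_entropy (A * mat_adjoint A) = - (\<Sum>i<r1. p i * ln (p i)) / ln 2"
      "weighted_entropy (frob2 A) A = (frob2 A * ln (frob2 A) - (\<Sum>i<r1. p i * ln (p i))) / ln 2"
      "\<forall>t\<ge>0. gram_det (of_real (sqrt t) \<cdot>\<^sub>m A) = of_real (\<Prod>i<r1. 1 + t * p i)"
    using gram_spectrum[OF A] by auto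
  note p = this[rule_format]
  obtain v where "\<forall>i<r2. 0 \<le> v i" "(\<Sum>i<r2. v i) = frob2 B"
      "vn_entropy (B * mat_adjoint B) = - (\<Sum>i<r2. v i * ln (v i)) / ln 2"
      "weighted_entropy (frob2 B) B = (frob2 B * ln (frob2 B) - (\<Sum>i<r2. v i * ln (v i))) / ln 2"
      "\<forall>t\<ge>0. gram_det (of_real (sqrt t) \<cdot>\<^sub>m B) = of_real (\<Prod>i<r2. 1 + t * v i)"
    using gram_spectrum[OF B] by auto
  note v = this[rule_format]
  obtain q where "\<forall>i<r2. 0 \<le> q i" "(\<Sum>i<r2. q i) = frob2 D"
      "vn_entropy (D * mat_adjoint D) = - (\<Sum>i<r2. q i * ln (q i)) / ln 2"
      "weighted_entropy (frob2 D) D = (frob2 D * ln (frob2 D) - (\<Sum>i<r2. q i * ln (q i))) / ln 2"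
      "\<forall>t\<ge>0. gram_det (of_real (sqrt t) \<cdot>\<^sub>m D) = of_real (\<Prod>i<r2. 1 + t * q i)"
    using gram_spectrum[OF D] by auto
  note q = this[rule_format]
  obtain s where "\<forall>i<r1 + r2. 0 \<le> s i" "(\<Sum>i<r1 + r2. s i) = frob2 T"
      "vn_entropy (T * mat_adjoint T) = - (\<Sum>i<r1 + r2. s i * ln (s i)) / ln 2"
      "weighted_entropy (frob2 T) T = (frob2 T * ln (frob2 T) - (\<Sum>i<r1 + r2. s i * ln (s i))) / ln 2"
      "\<forall>t\<ge>0. gram_det (of_real (sqrt t) \<cdot>\<^sub>m T) = of_real (\<Prod>i<r1 + r2. 1 + t * s i)"
    using gram_spectrum[OF T] by auto
  note s = this[rule_format]
  obtain N U V b where U: "U \<in> carrier_mat r2 N" and V: "V \<in> carrier_mat c1 N"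
    and UU: "U * mat_adjoint U = 1\<^sub>m r2" and VV: "V * mat_adjoint V = 1\<^sub>m c1"
    and UBV: "mat_adjoint U * (B * V) = mat_diag N (\<lambda>j. of_real (b j))"
    by (rule coisometric_diagonalization[OF B])
  have aU: "mat_adjoint U \<in> carrier_mat N r2" using U by simp
  have BV: "B * V \<in> carrier_mat r2 N" by (rule mult_carrier_mat[OF B V])
  define A' D' where "A' = A * V" and "D' = mat_adjoint U * D"
  have A': "A' \<in> carrier_mat r1 N" unfolding A'_def by (rule mult_carrier_mat[OF A V])
  have D': "D' \<in> carrier_mat N c2" unfolding D'_def by (rule mult_carrier_mat[OF aU D])
  \<comment> \<open>The diagonals of \<open>A'\<^sup>\<dagger> A'\<close> and
    \<open>D' D'\<^sup>\<dagger>\<close>; their totals remain \<alpha> and \<gamma> because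
    \<open>V\<close> is a coisometry and the adjoint of \<open>U\<close> an isometry.\<close>
  define a g where "a = (\<lambda>j. \<Sum>k<r1. (cmod (A' $$ (k, j)))\<^sup>2)" and "g = (\<lambda>j. \<Sum>k<c2. (cmod (D' $$ (j, k)))\<^sup>2)"
  have ag: "0 \<le> a j" "0 \<le> g j" for j by (simp_all add: a_def g_def sum_nonneg)
  have sum_a: "(\<Sum>j<N. a j) = frob2 A"
  proof -
    have "frob2 A' = frob2 A" unfolding A'_def by (rule frob2_mult_coisometry[OF A V VV])
    then show ?thesis using A' unfolding a_def frob2_def by (subst sum.swap) simp
  qed
  have sum_g: "(\<Sum>j<N. g j) = frob2 D"
  proof -
    have "frob2 D' = frob2 D" unfolding D'_def by (rule frob2_isometry_mult[OF D aU]) (simp add: UU)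
    then show ?thesis using D' by (simp add: g_def frob2_def)
  qed
  have sum_b: "(\<Sum>j<N. (b j)\<^sup>2) = frob2 B"
    unfolding frob2_diag[symmetric] UBV[symmetric]
    using frob2_isometry_mult[OF BV aU] frob2_mult_coisometry[OF B V VV] UU by simp
  \<comment> \<open>\<open>L\<close> is an isometry and \<open>R\<close> a coisometry, so
    \<open>gram_det\<close> does not change when T is replaced by L T R, whose lower left block is
    diagonal.\<close>
  define L R where "L = four_block_mat (1\<^sub>m r1) (0\<^sub>m r1 r2) (0\<^sub>m N r1) (mat_adjoint U)"
    and "R = four_block_mat V (0\<^sub>m c1 c2) (0\<^sub>m c2 N) (1\<^sub>m c2)"
  note oc = one_carrier_mat and zc = zero_carrier_mat
  have L: "L \<in> carrier_mat (r1 + N) (r1 + r2)" and R: "R \<in> carrier_mat (c1 + c2) (N + c2)"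
    unfolding L_def R_def by (rule four_block_carrier_mat[OF oc aU], rule four_block_carrier_mat[OF V oc])
  have aL: "mat_adjoint L = four_block_mat (1\<^sub>m r1) (0\<^sub>m r1 N) (0\<^sub>m r2 r1) U"
    unfolding L_def adj_four_block[OF oc zc zc aU] by simp
  have aV: "mat_adjoint V \<in> carrier_mat N c1" using V by simp
  have aR: "mat_adjoint R = four_block_mat (mat_adjoint V) (0\<^sub>m N c2) (0\<^sub>m c2 c1) (1\<^sub>m c2)"
    unfolding R_def adj_four_block[OF V zc zc oc] by simp
  have LL: "mat_adjoint L * L = 1\<^sub>m (r1 + r2)"
    unfolding aL unfolding L_def mult_four_block_mat[OF oc zc zc U oc zc zc aU] UU using U aU by simp
  have RR: "R * mat_adjoint R = 1\<^sub>m (c1 + c2)"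
    unfolding aR unfolding R_def mult_four_block_mat[OF V zc zc oc aV zc zc oc] VV using V aV by simp
  have LTR: "L * (T * R) = four_block_mat A' (0\<^sub>m r1 c2) (mat_diag N (\<lambda>j. of_real (b j))) D'"
  proof -
    have 1: "T * R = four_block_mat A' (0\<^sub>m r1 c2) (B * V) D"
      unfolding T_def R_def mult_four_block_mat[OF A zc B D V zc zc oc] A'_def
      using right_add_zero_mat[OF mult_carrier_mat[OF A V]] right_add_zero_mat[OF BV] left_add_zero_mat[OF D] A B D
      by simp
    show ?thesis
      unfolding 1 L_def mult_four_block_mat[OF oc zc zc aU A' zc BV D] UBV D'_def[symmetric]
      using right_add_zero_mat[OF A'] left_add_zero_mat[OF D'] left_mult_zero_mat[OF BV] A' D' BV D by simp
  qed
  have conj: "gram_det (of_real k \<cdot>\<^sub>m (L * (T * R))) = gram_det (of_real k \<cdot>\<^sub>m T)" for k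
  proof -
    have kT: "of_real k \<cdot>\<^sub>m T \<in> carrier_mat (r1 + r2) (c1 + c2)" using T by simp
    have "of_real k \<cdot>\<^sub>m (L * (T * R)) = L * ((of_real k \<cdot>\<^sub>m T) * R)"
      unfolding mult_smult_assoc_mat[OF T R] mult_smult_distrib[OF L mult_carrier_mat[OF T R]] ..
    then show ?thesis
      using gram_det_isometry_mult[OF mult_carrier_mat[OF kT R] L LL] gram_det_mult_coisometry[OF kT R RR] by simp
  qed
  have det: "(\<Prod>i<r1. 1 + t * p i) * (\<Prod>i<r2. 1 + t * q i)
      * (\<Prod>j<N. 1 + t * (b j)\<^sup>2 / ((1 + t * a j) * (1 + t * g j))) \<le> (\<Prod>i<r1 + r2. 1 + t * s i)"
    if t: "0 < t" for t
  proof -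
    \<comment> \<open>Scaling T by sqrt t turns 1 + T T' into 1 + t T T', with T' the adjoint of T,
      so the determinant inequality needs to be known only without parameter.\<close>
    let ?k = "complex_of_real (sqrt t)"
    have kA: "?k \<cdot>\<^sub>m A' \<in> carrier_mat r1 N" and kD: "?k \<cdot>\<^sub>m D' \<in> carrier_mat N c2" using A' D' by auto
    have kA_eq: "?k \<cdot>\<^sub>m A' = (?k \<cdot>\<^sub>m A) * V" unfolding A'_def mult_smult_assoc_mat[OF A V] ..
    have kD_eq: "?k \<cdot>\<^sub>m D' = mat_adjoint U * (?k \<cdot>\<^sub>m D)" unfolding D'_def mult_smult_distrib[OF aU D] ..
    have gA: "gram_det (?k \<cdot>\<^sub>m A') = of_real (\<Prod>i<r1. 1 + t * p i)"
      unfolding kA_eq using gram_det_mult_coisometry[OF smult_carrier_mat[OF A] V VV, of ?k] p(5) t by simp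
    have gD: "gram_det (?k \<cdot>\<^sub>m D') = of_real (\<Prod>i<r2. 1 + t * q i)"
      unfolding kD_eq using gram_det_isometry_mult[OF smult_carrier_mat[OF D] aU, of ?k] q(5) t UU by simp
    have kdiag: "?k \<cdot>\<^sub>m mat_diag N (\<lambda>j. of_real (b j)) = mat_diag N (\<lambda>j. of_real (sqrt t * b j))"
      by (rule eq_matI) (auto simp: mat_diag_index)
    have blk: "?k \<cdot>\<^sub>m (L * (T * R)) = four_block_mat (?k \<cdot>\<^sub>m A') (0\<^sub>m r1 c2) (mat_diag N (\<lambda>j. of_real (sqrt t * b j))) (?k \<cdot>\<^sub>m D')"
      unfolding LTR smult_four_block_mat[OF A' zc mat_diag_dim D'] kdiag by simp
    have gT: "gram_det (four_block_mat (?k \<cdot>\<^sub>m A') (0\<^sub>m r1 c2) (mat_diag N (\<lambda>j. of_real (sqrt t * b j))) (?k \<cdot>\<^sub>m D'))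
        = of_real (\<Prod>i<r1 + r2. 1 + t * s i)"
      unfolding blk[symmetric] conj using s(5) t by simp
    have x: "1 + (\<Sum>k<r1. (cmod ((?k \<cdot>\<^sub>m A') $$ (k, j)))\<^sup>2) = 1 + t * a j" if "j < N" for j
      using that A' t by (simp add: a_def norm_mult power_mult_distrib sum_distrib_left)
    have z: "1 + (\<Sum>k<c2. (cmod ((?k \<cdot>\<^sub>m D') $$ (j, k)))\<^sup>2) = 1 + t * g j" if "j < N" for j
      using that D' t by (simp add: g_def norm_mult power_mult_distrib sum_distrib_left)
    have "(\<Prod>j<N. 1 + (sqrt t * b j)\<^sup>2 / ((1 + (\<Sum>k<r1. (cmod ((?k \<cdot>\<^sub>m A') $$ (k, j)))\<^sup>2)) * (1 + (\<Sum>k<c2. (cmod ((?k \<cdot>\<^sub>m D') $$ (j, k)))\<^sup>2))))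
        = (\<Prod>j<N. 1 + t * (b j)\<^sup>2 / ((1 + t * a j) * (1 + t * g j)))"
      using t by (intro prod.cong refl) (simp only: x z lessThan_iff power_mult_distrib real_sqrt_pow2 less_imp_le)
    moreover have pos: "0 \<le> (\<Prod>i<n. 1 + t * f i)" if "\<And>i. i < n \<Longrightarrow> 0 \<le> f i" for n :: nat and f
      using that t by (intro prod_nonneg) (auto intro!: add_nonneg_nonneg)
    ultimately show ?thesis
      using gram_det_lower_block_ge[OF kA kD, of "\<lambda>j. sqrt t * b j"] p(1) q(1) s(1)
      unfolding gA gD gT norm_of_real by (simp add: abs_of_nonneg del: of_real_prod)
  qed
  have key: "(\<Sum>i<r1 + r2. s i * ln (s i)) - (\<Sum>i<r1. p i * ln (p i)) - (\<Sum>i<r2. q i * ln (q i)) - (\<Sum>j<N. (b j)\<^sup>2 * ln ((b j)\<^sup>2))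
    \<le> entropy_gap (\<Sum>j<N. a j) (\<Sum>j<N. (b j)\<^sup>2) (\<Sum>j<N. g j)"
  proof (rule entropy_from_lower_block_dets[where p = p and q = q and s = s, OF s(1) p(1) q(1) ag])
    show "(\<Sum>i<r1 + r2. s i) = (\<Sum>j<N. a j) + (\<Sum>j<N. (b j)\<^sup>2) + (\<Sum>j<N. g j)"
      unfolding s(2) sum_a sum_b sum_g T_def by (rule frob2_lower_block[OF A B D])
  qed (use det sum_a sum_g p(2) q(2) in auto)
  \<comment> \<open>The squared singular values on the enlarged space replace the spectrum
    \<open>v\<close> of B: \<open>U\<close> and \<open>V\<close> leave \<open>gram_det\<close> of
    every multiple of B unchanged.\<close>
  have "(\<Sum>j<N. (b j)\<^sup>2 * ln ((b j)\<^sup>2)) \<le> (\<Sum>i<r2. v i * ln (v i))"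
  proof (rule xlnx_sum_mono)
    fix t :: real assume t: "0 < t"
    let ?k = "complex_of_real (sqrt t)"
    have kB: "?k \<cdot>\<^sub>m B \<in> carrier_mat r2 c1" using B by simp
    have "mat_adjoint U * ((?k \<cdot>\<^sub>m B) * V) = ?k \<cdot>\<^sub>m mat_diag N (\<lambda>j. of_real (b j))"
      unfolding UBV[symmetric] mult_smult_assoc_mat[OF B V] mult_smult_distrib[OF aU BV] ..
    also have "\<dots> = mat_diag N (\<lambda>j. of_real (sqrt t * b j))"
      by (rule eq_matI) (auto simp: mat_diag_index)
    finally have "of_real (\<Prod>j<N. 1 + (sqrt t * b j)\<^sup>2) = gram_det (?k \<cdot>\<^sub>m B)"
      using gram_det_diag[of N "\<lambda>j. sqrt t * b j"] gram_det_isometry_mult[OF mult_carrier_mat[OF kB V] aU]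
        gram_det_mult_coisometry[OF kB V VV] UU by simp
    also have "\<dots> = of_real (\<Prod>i<r2. 1 + t * v i)" using v(5) t by simp
    finally have "(\<Prod>j<N. 1 + (sqrt t * b j)\<^sup>2) = (\<Prod>i<r2. 1 + t * v i)" by (metis of_real_eq_iff)
    then show "(\<Prod>i<r2. 1 + t * v i) = (\<Prod>j<N. 1 + t * (b j)\<^sup>2)"
      using t by (simp add: power_mult_distrib)
  qed (use v sum_b in auto)
  with key have "(\<Sum>i<r1 + r2. s i * ln (s i)) \<le> entropy_gap \<alpha> \<beta> \<gamma>
      + (\<Sum>i<r1. p i * ln (p i)) + (\<Sum>i<r2. v i * ln (v i)) + (\<Sum>i<r2. q i * ln (q i))"
    unfolding sum_a sum_b sum_g weights by linarith
  then have "- (big_root \<alpha> \<beta> \<gamma> * ln (big_root \<alpha> \<beta> \<gamma>) + small_root \<alpha> \<beta> \<gamma> * ln (small_root \<alpha> \<beta> \<gamma>))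
      + (\<alpha> * ln \<alpha> - (\<Sum>i<r1. p i * ln (p i))) + (\<beta> * ln \<beta> - (\<Sum>i<r2. v i * ln (v i)))
      + (\<gamma> * ln \<gamma> - (\<Sum>i<r2. q i * ln (q i))) \<le> - (\<Sum>i<r1 + r2. s i * ln (s i))"
    unfolding entropy_gap_def by linarith
  then have "(- (big_root \<alpha> \<beta> \<gamma> * ln (big_root \<alpha> \<beta> \<gamma>) + small_root \<alpha> \<beta> \<gamma> * ln (small_root \<alpha> \<beta> \<gamma>))
      + (\<alpha> * ln \<alpha> - (\<Sum>i<r1. p i * ln (p i))) + (\<beta> * ln \<beta> - (\<Sum>i<r2. v i * ln (v i)))
      + (\<gamma> * ln \<gamma> - (\<Sum>i<r2. q i * ln (q i)))) / ln 2 \<le> - (\<Sum>i<r1 + r2. s i * ln (s i)) / ln 2"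
    by (rule divide_right_mono) simp
  moreover have "e_fun (2 * sqrt (\<alpha> * \<gamma>)) = - (big_root \<alpha> \<beta> \<gamma> * ln (big_root \<alpha> \<beta> \<gamma>) + small_root \<alpha> \<beta> \<gamma> * ln (small_root \<alpha> \<beta> \<gamma>)) / ln 2"
    using assms(12) frob2_nonneg by (intro e_fun_roots) (simp_all add: weights)
  ultimately show ?thesis
    unfolding s(3) using p(4) v(4) q(4) by (simp only: weights add_divide_distrib)
qed

end
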